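(* Let $\mathbb{F}$ be a field, let $\mathcal{V} \subseteq \mathbb{F}^{m \times n}$ and $\mathcal{W} \subseteq \mathbb{F}^{m \times n'}$ be rank support spaces, and let $\phi : \mathcal{V} \to \mathcal{W}$ be an $\mathbb{F}$-linear vector space isomorphism. Consider the properties: (P1) there exist full-rank matrices $A \in \mathbb{F}^{m \times m}$ and $B \in \mathbb{F}^{n \times n'}$ such that $\phi(C) = ACB$ for all $C \in \mathcal{V}$; (P2) a subspace $\mathcal{U} \subseteq \mathcal{V}$ is a rank support space if and only if $\phi(\mathcal{U})$ is a rank support space; (P3) for every subspace $\mathcal{D} \subseteq \mathcal{V}$, ${\rm wt_R}(\phi(\mathcal{D})) = {\rm wt_R}(\mathcal{D})$; (P4) ${\rm Rk}(\phi(V)) = {\rm Rk}(V)$ for all $V \in \mathcal{V}$ (i.e. $\phi$ is a rank isometry). Then (P1) $\Leftrightarrow$ (P2) $\Leftrightarrow$ (P3) $\Rightarrow$ (P4). Moreover, in the case $\mathcal{V} = \mathcal{W} = \mathbb{F}^{m \times n}$ (so $n'=n$) and $m \neq n$, (P4) implies (P1) as well.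
   Context: For $C \in \mathbb{F}^{m\times n}$, ${\rm Row}(C) \subseteq \mathbb{F}^n$ is the row space and ${\rm Rk}(C) = \dim {\rm Row}(C)$. For a subspace $\mathcal{D} \subseteq \mathbb{F}^{m \times n}$, its rank support is ${\rm RSupp}(\mathcal{D}) = \sum_{C \in \mathcal{D}} {\rm Row}(C) \subseteq \mathbb{F}^n$ and its rank weight is ${\rm wt_R}(\mathcal{D}) = \dim {\rm RSupp}(\mathcal{D})$. For a subspace $\mathcal{L} \subseteq \mathbb{F}^n$, $\mathcal{V}_\mathcal{L} = \{V \in \mathbb{F}^{m\times n} \mid {\rm Row}(V) \subseteq \mathcal{L}\}$; a rank support space in $\mathbb{F}^{m \times n}$ is a set of the form $\mathcal{V}_\mathcal{L}$ for some subspace $\mathcal{L} \subseteq \mathbb{F}^n$ (analogously in $\mathbb{F}^{m\times n'}$). *)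

theory Defs
  imports "Jordan_Normal_Form.VS_Connect"
begin

definition subspace_vec :: "nat \<Rightarrow> 'a::field vec set \<Rightarrow> bool" where
  "subspace_vec k L \<longleftrightarrow> subspace (class_ring :: 'a ring) L (module_vec TYPE('a) k)"

definition subspace_mat :: "nat \<Rightarrow> nat \<Rightarrow> 'a::field mat set \<Rightarrow> bool" where
  "subspace_mat m n D \<longleftrightarrow> subspace (class_ring :: 'a ring) D (module_mat TYPE('a) m n)"

definition dim_vec :: "nat \<Rightarrow> 'a::field vec set \<Rightarrow> nat" where
  "dim_vec k L = vectorspace.dim (class_ring :: 'a ring) ((module_vec TYPE('a) k)\<lparr>carrier := L\<rparr>)"

definition span_vec :: "nat \<Rightarrow> 'a::field vec set \<Rightarrow> 'a vec set" where
  "span_vec k S = LinearCombinations.module.span (class_ring :: 'a ring) (module_vec TYPE('a) k) S"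

definition Row :: "'a::field mat \<Rightarrow> 'a vec set" where
  "Row C = span_vec (dim_col C) (set (rows C))"

definition Rk :: "'a::field mat \<Rightarrow> nat" where
  "Rk C = dim_vec (dim_col C) (Row C)"

definition RSupp :: "nat \<Rightarrow> 'a::field mat set \<Rightarrow> 'a vec set" where
  "RSupp n D = span_vec n (\<Union>C\<in>D. Row C)"

definition wtR :: "nat \<Rightarrow> 'a::field mat set \<Rightarrow> nat" where
  "wtR n D = dim_vec n (RSupp n D)"

definition VL :: "nat \<Rightarrow> nat \<Rightarrow> 'a::field vec set \<Rightarrow> 'a mat set" where
  "VL m n L = {V \<in> carrier_mat m n. Row V \<subseteq> L}"

definition rank_support_space :: "nat \<Rightarrow> nat \<Rightarrow> 'a::field mat set \<Rightarrow> bool" where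
  "rank_support_space m n D \<longleftrightarrow> (\<exists>L. subspace_vec n L \<and> D = VL m n L)"

end

theory Submission
  imports Defs
begin

text \<open>
  Write \<open>u \<otimes> v\<close> for the matrix \<open>outer u v\<close>. The pivot is the property that for every \<open>v \<in> L\<close> the
  image of \<open>{u \<otimes> v | u}\<close> lies in \<open>{u \<otimes> w | u}\<close> for a single \<open>w\<close> (\<open>preserves_lines\<close>).

  P2 implies it because the sets \<open>{u \<otimes> v | u}\<close> are the minimal nonzero rank support spaces, and P3
  because these sets have weight at most one. Conversely, fix \<open>v\<^sub>0 \<noteq> 0\<close> in \<open>L\<close> and write
  \<open>\<phi> (u \<otimes> v\<^sub>0) = A u \<otimes> w\<^sub>0\<close>. Comparing the images of \<open>u \<otimes> v\<^sub>0\<close>, \<open>u \<otimes> v\<close> and \<open>u \<otimes> (v\<^sub>0 + v)\<close> gives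
  \<open>\<phi> (u \<otimes> v) = A u \<otimes> f v\<close> with the same \<open>A\<close>, where \<open>f\<close> is linear and injective; extending \<open>f\<close>
  to a map of full rank yields \<open>B\<close>.

  For P4, a rank isometry maps \<open>{u \<otimes> v | u}\<close> to a space of matrices of rank at most one, so either
  the row factors or the column factors of its elements are proportional; for \<open>m > n\<close> the second
  case is excluded by dimension. For \<open>m < n\<close> one transposes.
\<close>

section \<open>Subspaces and row spaces\<close>

lemma mult_mat_zero_vec: "M \<in> carrier_mat n k \<Longrightarrow> M *\<^sub>v 0\<^sub>v k = 0\<^sub>v n"
  by (intro eq_vecI) auto

lemma smult_zero_vec [simp]: "(c :: 'a::field) \<cdot>\<^sub>v 0\<^sub>v n = 0\<^sub>v n"
  by (intro eq_vecI) auto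

lemma subspace_vec_iff:
  "subspace_vec k L \<longleftrightarrow> L \<subseteq> carrier_vec k \<and> 0\<^sub>v k \<in> L \<and>
     (\<forall>x\<in>L. \<forall>y\<in>L. x + y \<in> L) \<and> (\<forall>c. \<forall>x\<in>L. c \<cdot>\<^sub>v x \<in> L)"
  using vec_vs vec_module
  by (auto simp: subspace_vec_def subspace_def submodule_def module_vec_simps class_ring_simps)

lemma subspace_mat_iff:
  "subspace_mat m n D \<longleftrightarrow> D \<subseteq> carrier_mat m n \<and> 0\<^sub>m m n \<in> D \<and>
     (\<forall>x\<in>D. \<forall>y\<in>D. x + y \<in> D) \<and> (\<forall>c. \<forall>x\<in>D. c \<cdot>\<^sub>m x \<in> D)"
  using matrix_vs[of m n] 
  by (auto simp: subspace_mat_def subspace_def submodule_def module_mat_simps class_ring_simps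
      vectorspace_def)

lemma subspace_vec_carrier: "subspace_vec k (carrier_vec k)"
  by (auto simp: subspace_vec_iff)

lemma span_vec_superset:
  assumes "S \<subseteq> carrier_vec k"
  shows "S \<subseteq> span_vec k S"
proof -
  interpret vec_space "TYPE('a)" k .
  show ?thesis unfolding span_vec_def using in_own_span assms by simp
qed

lemma subspace_span_vec:
  assumes "S \<subseteq> carrier_vec k"
  shows "subspace_vec k (span_vec k S)"
proof -
  interpret vec_space "TYPE('a)" k .
  show ?thesis unfolding span_vec_def subspace_vec_def using span_is_subspace assms by simp
qed

lemma span_vec_least:
  assumes "S \<subseteq> L" and "subspace_vec k L"
  shows "span_vec k S \<subseteq> L"
proof -
  interpret vec_space "TYPE('a)" k .
  show ?thesis using span_is_subset[of S L] assms 
    unfolding span_vec_def subspace_vec_def by simp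
qed

text \<open>Combining the rows with coefficient vector \<open>y\<close> gives
  \<open>C\<^sup>T *\<^sub>v y\<close>. Row spaces thereby become ranges of matrices, on which
  images and dimensions can be computed.\<close>

lemma Row_eq_image:
  assumes "C \<in> carrier_mat m n"
  shows "Row C = (\<lambda>y. C\<^sup>T *\<^sub>v y) ` carrier_vec m"
proof -
  interpret vec_space "TYPE('a)" n .
  have "Row C = row_space C"
    using assms by (auto simp: Row_def span_vec_def row_space_def)
  also have "\<dots> = (\<lambda>y. C\<^sup>T *\<^sub>v y) ` carrier_vec m"
    using row_space_eq[OF assms] assms by (auto simp: image_def)
  finally show ?thesis .
qed

lemma subspace_Row:
  assumes "C \<in> carrier_mat m n"
  shows "subspace_vec n (Row C)"
  unfolding Row_def using assms subspace_span_vec[of "set (rows C)"] rows_carrier[of C] by auto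

text \<open>The rows generate the row space and \<open>L\<close> is closed under combinations, so
  testing the generators suffices.\<close>

lemma Row_subset_iff:
  assumes "C \<in> carrier_mat m n" and "subspace_vec n L"
  shows "Row C \<subseteq> L \<longleftrightarrow> (\<forall>i<m. row C i \<in> L)"
proof
  have rc: "set (rows C) \<subseteq> carrier_vec n" using assms rows_carrier[of C] by auto
  assume "Row C \<subseteq> L"
  then have "set (rows C) \<subseteq> L"
    using span_vec_superset[OF rc] assms by (auto simp: Row_def)
  then show "\<forall>i<m. row C i \<in> L" using assms by (auto simp: rows_def)
next
  assume "\<forall>i<m. row C i \<in> L"
  then have "set (rows C) \<subseteq> L" using assms by (auto simp: rows_def)
  then show "Row C \<subseteq> L" unfolding Row_def using assms span_vec_least[of _ L n] by auto
qed

lemma VL_eq: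
  assumes "subspace_vec n L"
  shows "VL m n L = {C \<in> carrier_mat m n. \<forall>i<m. row C i \<in> L}"
  using Row_subset_iff[OF _ assms] by (auto simp: VL_def)

lemma subspace_VL:
  assumes "subspace_vec n L"
  shows "subspace_mat m n (VL m n L)"
  using assms by (auto simp: subspace_mat_iff VL_eq subspace_vec_iff row_add row_smult)

lemma Union_Row_carrier:
  assumes "D \<subseteq> carrier_mat m n"
  shows "(\<Union>C\<in>D. Row C) \<subseteq> carrier_vec n"
proof (rule UN_least)
  fix C assume "C \<in> D"
  with assms have "C \<in> carrier_mat m n" by blast
  then show "Row C \<subseteq> carrier_vec n" using subspace_Row[of C m n] by (simp add: subspace_vec_iff)
qed

lemma subspace_RSupp:
  assumes "D \<subseteq> carrier_mat m n"
  shows "subspace_vec n (RSupp n D)"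
  unfolding RSupp_def by (rule subspace_span_vec[OF Union_Row_carrier[OF assms]])

lemma Row_subset_RSupp:
  assumes "D \<subseteq> carrier_mat m n" and "C \<in> D"
  shows "Row C \<subseteq> RSupp n D"
  using span_vec_superset[OF Union_Row_carrier[OF assms(1)]] assms(2) by (auto simp: RSupp_def)

lemma RSupp_least:
  assumes "\<And>C. C \<in> D \<Longrightarrow> Row C \<subseteq> L" and "subspace_vec n L"
  shows "RSupp n D \<subseteq> L"
  unfolding RSupp_def using assms by (intro span_vec_least) auto

section \<open>Matrices with trivial kernel\<close>

text \<open>Equivalently, the \<open>k\<close> columns are linearly independent. Such a matrix plays
  the role of a basis of its column space, so bases are handled as matrices throughout.\<close>

definition inj_mat :: "nat \<Rightarrow> nat \<Rightarrow> 'a::field mat \<Rightarrow> bool" where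
  "inj_mat n k M \<longleftrightarrow> M \<in> carrier_mat n k \<and> (\<forall>y\<in>carrier_vec k. M *\<^sub>v y = 0\<^sub>v n \<longrightarrow> y = 0\<^sub>v k)"

lemma inj_mat_left_inverse:
  assumes M: "M \<in> carrier_mat n k" and Q: "Q \<in> carrier_mat k n" and QM: "Q * M = 1\<^sub>m k"
  shows "inj_mat n k M"
  unfolding inj_mat_def
proof (intro conjI ballI impI M)
  fix y :: "'a vec" assume y: "y \<in> carrier_vec k" "M *\<^sub>v y = 0\<^sub>v n"
  have "y = (Q * M) *\<^sub>v y" using y QM by simp
  also have "\<dots> = Q *\<^sub>v (M *\<^sub>v y)" using M Q y by (simp add: assoc_mult_mat_vec)
  also have "\<dots> = 0\<^sub>v k" using y Q by auto
  finally show "y = 0\<^sub>v k" .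
qed

lemma inj_mat_square:
  assumes "inj_mat n n M"
  obtains Q where "Q \<in> carrier_mat n n" "M * Q = 1\<^sub>m n" "Q * M = 1\<^sub>m n"
proof -
  have M: "M \<in> carrier_mat n n" using assms by (simp add: inj_mat_def)
  have "det M \<noteq> 0"
    using assms det_0_iff_vec_prod_zero_field[OF M] by (auto simp: inj_mat_def)
  from det_non_zero_imp_unit[OF M this]
  show ?thesis using that by (auto simp: Units_def ring_mat_simps)
qed

text \<open>If \<open>n < k\<close>, padding \<open>M\<close> with zero rows to a square matrix
  keeps the kernel trivial. The padded matrix would then be invertible in spite of its zero
  row.\<close>

lemma inj_mat_le:
  assumes "inj_mat n k M"
  shows "k \<le> n"
proof (rule ccontr)
  assume "\<not> k \<le> n"
  then have nk: "n < k" by simp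
  have M: "M \<in> carrier_mat n k" using assms by (simp add: inj_mat_def)
  define N where "N = mat k k (\<lambda>(i,j). if i < n then M $$ (i,j) else 0)"
  have N: "N \<in> carrier_mat k k" by (simp add: N_def)
  have Ny: "N *\<^sub>v y = vec k (\<lambda>i. if i < n then (M *\<^sub>v y) $ i else 0)" if "y \<in> carrier_vec k" for y
    using that M nk by (intro eq_vecI) (auto simp: N_def scalar_prod_def)
  have "inj_mat k k N" unfolding inj_mat_def
  proof (intro conjI ballI impI N)
    fix y :: "'a vec" assume y: "y \<in> carrier_vec k" and "N *\<^sub>v y = 0\<^sub>v k"
    then have z: "vec k (\<lambda>i. if i < n then (M *\<^sub>v y) $ i else 0) = 0\<^sub>v k" using Ny by simp
    have "(M *\<^sub>v y) $ i = 0" if "i < n" for i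
      using arg_cong[OF z, of "\<lambda>v. v $ i"] that nk by simp
    then have "M *\<^sub>v y = 0\<^sub>v n" using M by (intro eq_vecI) auto
    then show "y = 0\<^sub>v k" using y assms by (simp add: inj_mat_def)
  qed
  then obtain Q where Q: "Q \<in> carrier_mat k k" "N * Q = 1\<^sub>m k" by (rule inj_mat_square)
  have "(N * Q) $$ (n, n) = 0" using nk Q(1) N by (auto simp: N_def scalar_prod_def)
  then show False using Q(2) nk by simp
qed

lemma surj_mat_right_inverse:
  fixes M :: "'a::field mat"
  assumes M: "M \<in> carrier_mat n k" and surj: "carrier_vec n \<subseteq> (\<lambda>y. M *\<^sub>v y) ` carrier_vec k"
  obtains Q where "Q \<in> carrier_mat k n" "M * Q = 1\<^sub>m n"
proof -
  \<comment> \<open>Preimages of the unit vectors become the columns of the right inverse.\<close>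
  have "\<exists>y\<in>carrier_vec k. M *\<^sub>v y = unit_vec n j" for j
    using surj unit_vec_carrier[of n j] by (metis (no_types, lifting) imageE subset_iff)
  then obtain q where q: "\<And>j. q j \<in> carrier_vec k" "\<And>j. M *\<^sub>v q j = unit_vec n j"
    by metis
  define Q where "Q = mat k n (\<lambda>(i,j). q j $ i)"
  have Q: "Q \<in> carrier_mat k n" by (simp add: Q_def)
  have colQ: "col Q j = q j" if "j < n" for j
    using that q(1)[of j] by (intro eq_vecI) (auto simp: Q_def)
  have "M * Q = 1\<^sub>m n"
  proof (rule mat_col_eqI)
    fix j assume "j < dim_col (1\<^sub>m n :: 'a mat)"
    then have j: "j < n" by simp
    show "col (M * Q) j = col (1\<^sub>m n) j" using col_mult2[OF M Q j] colQ[OF j] q(2) j by simp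
  qed (use M Q in auto)
  with Q that show ?thesis by blast
qed

section \<open>Extending independent columns to a basis\<close>

lemma mult_append_column:
  fixes M :: "'a::field mat"
  assumes M: "M \<in> carrier_mat n k" and x: "x \<in> carrier_vec n" and y: "y \<in> carrier_vec (Suc k)"
  shows "mat n (Suc k) (\<lambda>(i,j). if j < k then M $$ (i,j) else x $ i) *\<^sub>v y
       = M *\<^sub>v vec k (\<lambda>j. y $ j) + y $ k \<cdot>\<^sub>v x"
  using M x y by (intro eq_vecI) (auto simp: scalar_prod_def mult.commute)

text \<open>A kernel vector with nonzero last entry could be solved for \<open>x\<close>, putting
  \<open>x\<close> into the column space; with last entry zero it is a kernel vector of
  \<open>M\<close>.\<close>

lemma inj_mat_append_column:
  assumes M: "inj_mat n k M" and x: "x \<in> carrier_vec n" "x \<notin> (\<lambda>y. M *\<^sub>v y) ` carrier_vec k"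
  shows "inj_mat n (Suc k) (mat n (Suc k) (\<lambda>(i,j). if j < k then M $$ (i,j) else x $ i))"
    (is "inj_mat n _ ?M'")
  unfolding inj_mat_def
proof (intro conjI ballI impI)
  have Mc: "M \<in> carrier_mat n k" using M by (simp add: inj_mat_def)
  show "?M' \<in> carrier_mat n (Suc k)" by simp
  fix y :: "'a vec" assume y: "y \<in> carrier_vec (Suc k)" "?M' *\<^sub>v y = 0\<^sub>v n"
  define z where "z = vec k (\<lambda>j. y $ j)"
  have zc: "z \<in> carrier_vec k" by (simp add: z_def)
  have eq: "M *\<^sub>v z + y $ k \<cdot>\<^sub>v x = 0\<^sub>v n"
    using mult_append_column[OF Mc x(1) y(1)] y(2) by (simp add: z_def)
  have yk: "y $ k = 0"
  proof (rule ccontr)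
    assume nz: "y $ k \<noteq> 0"
    have "x = M *\<^sub>v ((- inverse (y $ k)) \<cdot>\<^sub>v z)"
    proof (rule eq_vecI)
      fix i assume "i < Matrix.dim_vec (M *\<^sub>v ((- inverse (y $ k)) \<cdot>\<^sub>v z))"
      then have i: "i < n" using Mc by simp
      have "(M *\<^sub>v z) $ i + y $ k * x $ i = 0"
        using arg_cong[OF eq, of "\<lambda>v. v $ i"] i x Mc by simp
      then have "x $ i = - inverse (y $ k) * (M *\<^sub>v z) $ i"
        using nz by (simp add: field_simps eq_neg_iff_add_eq_0)
      then show "x $ i = (M *\<^sub>v ((- inverse (y $ k)) \<cdot>\<^sub>v z)) $ i"
        using mult_mat_vec[OF Mc zc] i Mc by simp
    qed (use x Mc in auto)
    then have "x \<in> (\<lambda>y. M *\<^sub>v y) ` carrier_vec k" by (rule image_eqI) (use zc in simp)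
    then show False using x(2) by simp
  qed
  moreover have "0 \<cdot>\<^sub>v x = 0\<^sub>v n" using x(1) by auto
  ultimately have "M *\<^sub>v z = 0\<^sub>v n" using eq Mc zc by simp
  then have "z = 0\<^sub>v k" using M zc by (simp add: inj_mat_def)
  then have "z $ j = 0" if "j < k" for j using that by simp
  then have "y $ j = 0" if "j < k" for j using that by (simp add: z_def)
  then show "y = 0\<^sub>v (Suc k)" using y(1) yk by (intro eq_vecI) (auto simp: less_Suc_eq)
qed

lemma mult_mat_vec_in_subspace:
  assumes M: "M \<in> carrier_mat n k" and L: "subspace_vec n L" and cols: "\<And>j. j < k \<Longrightarrow> col M j \<in> L"
    and y: "y \<in> carrier_vec k"
  shows "M *\<^sub>v y \<in> L"
proof -
  have "row (M\<^sup>T) i \<in> L" if "i < k" for i using that cols M by simp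
  then have "Row (M\<^sup>T) \<subseteq> L" using Row_subset_iff[OF _ L, of "M\<^sup>T" k] M by auto
  then show ?thesis using Row_eq_image[of "M\<^sup>T" k n] M y by auto
qed

text \<open>Append vectors of \<open>L\<close> outside the current column space until none is left.
  Independence bounds the number of columns by \<open>n\<close>, so \<open>n - k\<close> decreases
  at each step. The original columns stay in front, which later allows a map to be prescribed on
  them.\<close>

lemma extend_to_basis:
  assumes L: "subspace_vec n L" and M: "inj_mat n k M" and cols: "\<And>j. j < k \<Longrightarrow> col M j \<in> L"
  shows "\<exists>k' M'. k \<le> k' \<and> inj_mat n k' M' \<and> (\<lambda>y. M' *\<^sub>v y) ` carrier_vec k' = L \<and>
           (\<forall>j<k. col M' j = col M j)"
  using M cols
proof (induction "n - k" arbitrary: k M rule: less_induct)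
  case less
  have Mc: "M \<in> carrier_mat n k" using less.prems by (simp add: inj_mat_def)
  show ?case
  proof (cases "(\<lambda>y. M *\<^sub>v y) ` carrier_vec k = L")
    case True
    then show ?thesis using less.prems by blast
  next
    case False
    have "(\<lambda>y. M *\<^sub>v y) ` carrier_vec k \<subseteq> L"
      using mult_mat_vec_in_subspace[OF Mc L less.prems(2)] by auto
    with False obtain x where x: "x \<in> L" "x \<notin> (\<lambda>y. M *\<^sub>v y) ` carrier_vec k" by auto
    then have xc: "x \<in> carrier_vec n" using L by (auto simp: subspace_vec_iff)
    define N where "N = mat n (Suc k) (\<lambda>(i,j). if j < k then M $$ (i,j) else x $ i)"
    have N: "inj_mat n (Suc k) N"
      unfolding N_def using inj_mat_append_column[OF less.prems(1) xc x(2)] .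
    have colN: "col N j = col M j" if "j < k" for j
      using that Mc by (intro eq_vecI) (auto simp: N_def)
    have "col N k = x" using xc by (intro eq_vecI) (auto simp: N_def)
    with colN less.prems(2) x(1) have "\<And>j. j < Suc k \<Longrightarrow> col N j \<in> L" by (auto simp: less_Suc_eq)
    moreover have "n - Suc k < n - k" using inj_mat_le[OF N] by simp
    ultimately obtain k' M' where
      "Suc k \<le> k'" "inj_mat n k' M'" "(\<lambda>y. M' *\<^sub>v y) ` carrier_vec k' = L"
      "\<forall>j<Suc k. col M' j = col N j" using less.hyps[OF _ N] by auto
    with colN show ?thesis by (intro exI[of _ k'] exI[of _ M']) auto
  qed
qed

lemma ex_basis_mat:
  assumes "subspace_vec n L"
  obtains k M where "inj_mat n k M" "(\<lambda>y. M *\<^sub>v y) ` carrier_vec k = L"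
proof -
  \<comment> \<open>The extension starts from the matrix without columns, the empty basis.\<close>
  have "inj_mat n 0 (0\<^sub>m n 0 :: 'a mat)" by (auto simp: inj_mat_def)
  from extend_to_basis[OF assms this] that show ?thesis by auto
qed

lemma extend_to_invertible:
  assumes "inj_mat n k M"
  obtains P Q where "P \<in> carrier_mat n n" "Q \<in> carrier_mat n n" "P * Q = 1\<^sub>m n" "Q * P = 1\<^sub>m n"
    "\<And>j. j < k \<Longrightarrow> col P j = col M j"
proof -
  have M: "M \<in> carrier_mat n k" using assms by (simp add: inj_mat_def)
  obtain l P where P: "inj_mat n l P" "(\<lambda>y. P *\<^sub>v y) ` carrier_vec l = carrier_vec n"
    "\<And>j. j < k \<Longrightarrow> col P j = col M j"
    using extend_to_basis[OF subspace_vec_carrier assms] M by auto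
  have Pc: "P \<in> carrier_mat n l" using P by (simp add: inj_mat_def)
  obtain Q where Q: "Q \<in> carrier_mat l n" "P * Q = 1\<^sub>m n"
    using surj_mat_right_inverse[OF Pc] P(2) by blast
  \<comment> \<open>\<open>P\<close> is a left inverse of \<open>Q\<close>, so \<open>Q\<close> has
    independent columns as well. The size bounds for \<open>P\<close> and for \<open>Q\<close>
    together force \<open>P\<close> to be square.\<close>
  have "n \<le> l" using inj_mat_le[OF inj_mat_left_inverse[OF Q(1) Pc Q(2)]] .
  with inj_mat_le[OF P(1)] have l: "l = n" by simp
  show ?thesis
    using that[of P Q] Pc Q P(3) mat_mult_left_right_inverse[of P n Q] unfolding l by blast
qed

section \<open>Dimension\<close>

text \<open>\<open>M\<close> is a linear isomorphism from the coordinate space of dimension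
  \<open>k\<close> onto its range. All later dimension counts go back to this one.\<close>

lemma dim_vec_range_inj_mat:
  fixes M :: "'a::field mat"
  assumes M: "inj_mat n k M"
  shows "dim_vec n ((\<lambda>y. M *\<^sub>v y) ` carrier_vec k) = k"
proof -
  let ?L = "(\<lambda>y. M *\<^sub>v y) ` carrier_vec k"
  interpret V: vec_space "TYPE('a)" k .
  interpret W: vec_space "TYPE('a)" n .
  have Mc: "M \<in> carrier_mat n k" using M by (simp add: inj_mat_def)
  have "?L = Row (M\<^sup>T)" using Row_eq_image[of "M\<^sup>T" k n] Mc by simp
  then have L: "subspace_vec n ?L" using subspace_Row[of "M\<^sup>T" k n] Mc by simp
  let ?W = "module_vec TYPE('a) n\<lparr>carrier := ?L\<rparr>"
  have vsL: "vectorspace class_ring ?W"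
    using W.subspace_is_vs L unfolding subspace_vec_def by blast
  have lin: "linear_map class_ring (module_vec TYPE('a) k) ?W (\<lambda>y. M *\<^sub>v y)"
  proof -
    have "mod_hom class_ring (module_vec TYPE('a) k) ?W (\<lambda>y. M *\<^sub>v y)"
      using vsL vec_module[where 'a='a, of k] mult_add_distrib_mat_vec[OF Mc] mult_mat_vec[OF Mc]
      unfolding mod_hom_def mod_hom_axioms_def LinearCombinations.module_hom_def vectorspace_def
      by (auto simp: module_vec_simps class_ring_simps)
    then show ?thesis
      using vsL vec_vs[where 'a='a, of k] by (simp add: linear_map_def)
  qed
  have inj: "inj_on (\<lambda>y. M *\<^sub>v y) (carrier_vec k)"
  proof (rule inj_onI)
    fix x y assume xy: "x \<in> carrier_vec k" "y \<in> carrier_vec k" "M *\<^sub>v x = M *\<^sub>v y"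
    then have "M *\<^sub>v (x - y) = 0\<^sub>v n"
      using Mc by (simp add: mult_minus_distrib_mat_vec)
    then have "x - y = 0\<^sub>v k" using M xy by (simp add: inj_mat_def)
    then have "\<And>i. i < k \<Longrightarrow> (x - y) $ i = 0" by simp
    then show "x = y" using xy by (intro eq_vecI) auto
  qed
  have "V.dim = vectorspace.dim class_ring ?W"
    using linear_map.dim_eq[OF lin] inj by simp
  then show ?thesis using V.dim_is_n by (simp add: dim_vec_def)
qed


text \<open>If the columns of \<open>M\<close> form a basis of \<open>S\<close>, those of
  \<open>N * M\<close> form a basis of the image. Injectivity is asked for on \<open>S\<close> only,
  because the matrix to which this is applied may have a kernel outside the subspace in
  question.\<close>

lemma dim_vec_image:
  assumes S: "subspace_vec n S" and N: "N \<in> carrier_mat n' n"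
    and inj: "\<And>x. x \<in> S \<Longrightarrow> N *\<^sub>v x = 0\<^sub>v n' \<Longrightarrow> x = 0\<^sub>v n"
  shows "dim_vec n' ((\<lambda>x. N *\<^sub>v x) ` S) = dim_vec n S"
proof -
  obtain k M where M: "inj_mat n k M" "(\<lambda>y. M *\<^sub>v y) ` carrier_vec k = S"
    using ex_basis_mat[OF S] .
  have Mc: "M \<in> carrier_mat n k" using M by (simp add: inj_mat_def)
  have NM: "(N * M) *\<^sub>v y = N *\<^sub>v (M *\<^sub>v y)" if "y \<in> carrier_vec k" for y
    using N Mc that by (rule assoc_mult_mat_vec)
  have "inj_mat n' k (N * M)"
    using M inj N Mc NM by (auto simp: inj_mat_def)
  moreover have "(\<lambda>x. N *\<^sub>v x) ` S = (\<lambda>y. (N * M) *\<^sub>v y) ` carrier_vec k"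
    using NM by (auto simp: M(2)[symmetric] image_image)
  ultimately show ?thesis
    using dim_vec_range_inj_mat[of n' k "N * M"] dim_vec_range_inj_mat[OF M(1)] M(2) by simp
qed

lemma dim_vec_carrier: "dim_vec n (carrier_vec n :: 'a::field vec set) = n"
proof -
  have "inj_mat n n (1\<^sub>m n :: 'a mat)" by (auto simp: inj_mat_def)
  from dim_vec_range_inj_mat[OF this] show ?thesis by simp
qed

text \<open>For \<open>v = 0\<close> this is the zero space, so that every subspace of dimension at
  most one, zero included, is a line.\<close>

definition line :: "'a::field vec \<Rightarrow> 'a vec set" where
  "line v = range (\<lambda>c. c \<cdot>\<^sub>v v)"

lemma smult_in_line [simp]: "c \<cdot>\<^sub>v v \<in> line v"
  by (simp add: line_def)

lemma self_in_line [simp]: "v \<in> line v"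
  unfolding line_def by (rule range_eqI[of _ _ 1]) simp

lemma subspace_line:
  assumes "v \<in> carrier_vec n"
  shows "subspace_vec n (line v)"
proof -
  have "0\<^sub>v n = 0 \<cdot>\<^sub>v v" using assms by auto
  then have "0\<^sub>v n \<in> line v" by simp
  moreover have "a \<cdot>\<^sub>v v + b \<cdot>\<^sub>v v = (a + b) \<cdot>\<^sub>v v" for a b
    using assms by (simp add: add_smult_distrib_vec)
  then have "x + y \<in> line v" if "x \<in> line v" "y \<in> line v" for x y
    using that unfolding line_def by force
  moreover have "a \<cdot>\<^sub>v (b \<cdot>\<^sub>v v) = (a * b) \<cdot>\<^sub>v v" for a b
    by (simp add: smult_smult_assoc)
  then have "c \<cdot>\<^sub>v x \<in> line v" if "x \<in> line v" for c x
    using that unfolding line_def by force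
  moreover have "line v \<subseteq> carrier_vec n" using assms by (auto simp: line_def)
  ultimately show ?thesis by (auto simp: subspace_vec_iff)
qed

lemma line_subset:
  assumes "subspace_vec n L" and "v \<in> L"
  shows "line v \<subseteq> L"
  using assms by (auto simp: line_def subspace_vec_iff)

lemma dim_vec_le_1D:
  assumes S: "subspace_vec n S" and "dim_vec n S \<le> 1"
  obtains w where "w \<in> S" "S \<subseteq> line w"
proof -
  obtain k M where M: "inj_mat n k M" "(\<lambda>y. M *\<^sub>v y) ` carrier_vec k = S"
    using ex_basis_mat[OF S] .
  have Mc: "M \<in> carrier_mat n k" using M by (simp add: inj_mat_def)
  have k: "k \<le> 1" using dim_vec_range_inj_mat[OF M(1)] M(2) assms(2) by simp
  \<comment> \<open>Multiplying by the all-ones vector treats both cases at once: for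
    \<open>k = 1\<close> it returns the single basis vector, for \<open>k = 0\<close> the zero
    vector.\<close>
  define w where "w = M *\<^sub>v vec k (\<lambda>_. 1)"
  have "w \<in> S" unfolding w_def M(2)[symmetric] by auto
  moreover have "M *\<^sub>v y \<in> line w" if "y \<in> carrier_vec k" for y
  proof -
    have "y = y $ 0 \<cdot>\<^sub>v vec k (\<lambda>_. 1)"
    proof (rule eq_vecI)
      fix i assume "i < Matrix.dim_vec (y $ 0 \<cdot>\<^sub>v vec k (\<lambda>_. 1))"
      then have "i < k" "i = 0" using k by auto
      then show "y $ i = (y $ 0 \<cdot>\<^sub>v vec k (\<lambda>_. 1)) $ i" by simp
    qed (use that in simp)
    then have "M *\<^sub>v y = M *\<^sub>v (y $ 0 \<cdot>\<^sub>v vec k (\<lambda>_. 1))" by simp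
    also have "\<dots> = y $ 0 \<cdot>\<^sub>v w" unfolding w_def by (rule mult_mat_vec[OF Mc]) simp
    finally show ?thesis by simp
  qed
  ultimately show ?thesis using that[of w] M(2) by auto
qed

text \<open>Two basis vectors \<open>a 0 \<cdot>\<^sub>v v\<close> and
  \<open>a 1 \<cdot>\<^sub>v v\<close> satisfy the relation with coefficients \<open>a 1\<close> and
  \<open>- a 0\<close>. Independence gives \<open>a 1 = 0\<close>, and then the second basis vector
  vanishes.\<close>

lemma dim_vec_le_1I:
  assumes S: "subspace_vec n S" and Sv: "S \<subseteq> line v"
  shows "dim_vec n S \<le> 1"
proof (rule ccontr)
  assume contr: "\<not> dim_vec n S \<le> 1"
  obtain k M where M: "inj_mat n k M" "(\<lambda>y. M *\<^sub>v y) ` carrier_vec k = S"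
    using ex_basis_mat[OF S] .
  have Mc: "M \<in> carrier_mat n k" using M by (simp add: inj_mat_def)
  have k: "1 < k" using dim_vec_range_inj_mat[OF M(1)] M(2) contr by simp
  have "M *\<^sub>v unit_vec k i \<in> S" for i unfolding M(2)[symmetric] by auto
  then have "M *\<^sub>v unit_vec k i \<in> line v" for i using Sv by blast
  then have "\<forall>i. \<exists>c. M *\<^sub>v unit_vec k i = c \<cdot>\<^sub>v v" by (simp add: line_def image_iff)
  from choice[OF this] obtain a where "\<forall>i. M *\<^sub>v unit_vec k i = a i \<cdot>\<^sub>v v" ..
  then have a: "M *\<^sub>v unit_vec k i = a i \<cdot>\<^sub>v v" for i by simp
  have v: "a i \<cdot>\<^sub>v v \<in> carrier_vec n" for i unfolding a[symmetric] using Mc by auto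
  have "M *\<^sub>v (a 1 \<cdot>\<^sub>v unit_vec k 0 - a 0 \<cdot>\<^sub>v unit_vec k 1) = a 1 \<cdot>\<^sub>v (a 0 \<cdot>\<^sub>v v) - a 0 \<cdot>\<^sub>v (a 1 \<cdot>\<^sub>v v)"
    using a by (simp add: mult_minus_distrib_mat_vec[OF Mc] mult_mat_vec[OF Mc])
  also have "\<dots> = 0\<^sub>v n" using v by (intro eq_vecI) auto
  finally have z: "a 1 \<cdot>\<^sub>v unit_vec k 0 - a 0 \<cdot>\<^sub>v unit_vec k 1 = 0\<^sub>v k"
    using M(1) by (simp add: inj_mat_def)
  have "a 1 = 0" using arg_cong[OF z, of "\<lambda>x. x $ 0"] k by simp
  then have "M *\<^sub>v unit_vec k 1 = 0\<^sub>v n" using a[of 1] v[of 1] by auto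
  then have "unit_vec k 1 = (0\<^sub>v k :: 'a vec)" using M(1) by (simp add: inj_mat_def)
  from arg_cong[OF this, of "\<lambda>x. x $ 1"] show False using k by simp
qed

section \<open>Full rank and invertibility of square matrices\<close>

lemma Rk_invertible:
  assumes "A \<in> carrier_mat m m" "Q \<in> carrier_mat m m" "A * Q = 1\<^sub>m m"
  shows "Rk A = m"
proof -
  have "Q\<^sup>T * A\<^sup>T = 1\<^sub>m m" using transpose_mult[of A m m Q m] assms by simp
  then have "inj_mat m m (A\<^sup>T)" using inj_mat_left_inverse[of "A\<^sup>T" m m "Q\<^sup>T"] assms by simp
  from dim_vec_range_inj_mat[OF this] show ?thesis
    using Row_eq_image[OF assms(1)] assms(1) by (simp add: Rk_def)
qed

lemma Rk_full_imp_invertible: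
  assumes A: "A \<in> carrier_mat m m" and rk: "Rk A = m"
  obtains Q where "Q \<in> carrier_mat m m" "A * Q = 1\<^sub>m m" "Q * A = 1\<^sub>m m"
proof -
  obtain k M where M: "inj_mat m k M" "(\<lambda>y. M *\<^sub>v y) ` carrier_vec k = Row A"
    using ex_basis_mat[OF subspace_Row[OF A]] .
  have "k = m" using dim_vec_range_inj_mat[OF M(1)] M(2) rk A by (simp add: Rk_def)
  with M have M: "inj_mat m m M" "(\<lambda>y. M *\<^sub>v y) ` carrier_vec m = Row A" by auto
  have Mc: "M \<in> carrier_mat m m" using M by (simp add: inj_mat_def)
  obtain N where N: "N \<in> carrier_mat m m" "M * N = 1\<^sub>m m" using inj_mat_square[OF M(1)] by blast
  \<comment> \<open>The basis matrix of the row space is square and invertible, so the row space is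
    everything. Hence \<open>A\<^sup>T\<close> is onto and has a right inverse, whose transpose
    inverts \<open>A\<close> from the left.\<close>
  have "x = M *\<^sub>v (N *\<^sub>v x)" if "x \<in> carrier_vec m" for x
    using assoc_mult_mat_vec[OF Mc N(1) that] N(2) that by simp
  then have "carrier_vec m \<subseteq> (\<lambda>y. M *\<^sub>v y) ` carrier_vec m" using N(1) by fastforce
  then have "carrier_vec m \<subseteq> (\<lambda>y. A\<^sup>T *\<^sub>v y) ` carrier_vec m"
    using M(2) Row_eq_image[OF A] by simp
  then obtain Y where Y: "Y \<in> carrier_mat m m" "A\<^sup>T * Y = 1\<^sub>m m"
    using surj_mat_right_inverse[of "A\<^sup>T" m m] A by auto
  have "Y\<^sup>T * A = 1\<^sub>m m" using transpose_mult[of "A\<^sup>T" m m Y m] Y A by simp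
  then show ?thesis using that[of "Y\<^sup>T"] mat_mult_left_right_inverse[of "Y\<^sup>T" m A] Y A by simp
qed

text \<open>\<open>f\<close> is linear on \<open>L\<close> only and unspecified elsewhere. In the
  coordinates given by the columns of \<open>M\<close> it acts as the matrix whose columns are the
  values of \<open>f\<close> at these columns.\<close>

lemma linear_on_range:
  fixes f :: "'a::field vec \<Rightarrow> 'a vec"
  assumes L: "subspace_vec n L" and M: "M \<in> carrier_mat n k" and cols: "\<And>j. j < k \<Longrightarrow> col M j \<in> L"
    and f: "\<And>x. x \<in> L \<Longrightarrow> f x \<in> carrier_vec r"
    and add: "\<And>x y. x \<in> L \<Longrightarrow> y \<in> L \<Longrightarrow> f (x + y) = f x + f y"
    and smult: "\<And>c x. x \<in> L \<Longrightarrow> f (c \<cdot>\<^sub>v x) = c \<cdot>\<^sub>v f x"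
    and y: "y \<in> carrier_vec k"
  shows "f (M *\<^sub>v y) = mat r k (\<lambda>(i,j). f (col M j) $ i) *\<^sub>v y"
proof -
  let ?N = "mat r k (\<lambda>(i,j). f (col M j) $ i)"
  have N: "?N \<in> carrier_mat r k" by simp
  have rangeL: "M *\<^sub>v z \<in> L" if "z \<in> carrier_vec k" for z
    using mult_mat_vec_in_subspace[OF M L cols that] .
  have unit: "B *\<^sub>v unit_vec k j = col B j" if "B \<in> carrier_mat b k" "j < k" for B :: "'a mat" and b j
    using that by (intro eq_vecI) auto
  \<comment> \<open>Induction on a bound \<open>t\<close> for the support of \<open>y\<close>: only
    entries with index below \<open>t\<close> may be nonzero. For \<open>t = k\<close> this is no
    restriction.\<close>
  have "f (M *\<^sub>v y) = ?N *\<^sub>v y" if "y \<in> carrier_vec k" "\<forall>j. t \<le> j \<and> j < k \<longrightarrow> y $ j = 0" for t y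
    using that
  proof (induction t arbitrary: y)
    case 0
    then have y0: "y = 0\<^sub>v k" by (intro eq_vecI) auto
    have "f (M *\<^sub>v 0\<^sub>v k) = f (0 \<cdot>\<^sub>v 0\<^sub>v n)" using mult_mat_zero_vec[OF M] by simp
    also have "\<dots> = 0 \<cdot>\<^sub>v f (0\<^sub>v n)" using L by (intro smult) (simp add: subspace_vec_iff)
    also have "\<dots> = 0\<^sub>v r" using f[of "0\<^sub>v n"] L by (auto simp: subspace_vec_iff)
    also have "\<dots> = ?N *\<^sub>v 0\<^sub>v k" using mult_mat_zero_vec[OF N] by simp
    finally show ?case using y0 by simp
  next
    case (Suc t)
    show ?case
    proof (cases "t < k")
      case False
      then show ?thesis using Suc.prems by (intro Suc.IH) auto
    next
      case True
      define z where "z = vec k (\<lambda>j. if j = t then 0 else y $ j)"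
      have z: "z \<in> carrier_vec k" "\<forall>j. t \<le> j \<and> j < k \<longrightarrow> z $ j = 0"
        using Suc.prems by (auto simp: z_def)
      have y: "y = z + y $ t \<cdot>\<^sub>v unit_vec k t"
        using Suc.prems True by (intro eq_vecI) (auto simp: z_def)
      have split: "B *\<^sub>v y = B *\<^sub>v z + y $ t \<cdot>\<^sub>v col B t" if "B \<in> carrier_mat b k" for B b
        using that unit[OF that True]
        by (subst y) (simp add: mult_add_distrib_mat_vec[OF that z(1)] mult_mat_vec[OF that])
      have "f (M *\<^sub>v y) = f (M *\<^sub>v z) + y $ t \<cdot>\<^sub>v f (col M t)"
        using rangeL[OF z(1)] cols[OF True] L
        by (simp add: split[OF M] add smult subspace_vec_iff)
      also have "f (M *\<^sub>v z) = ?N *\<^sub>v z" using z by (rule Suc.IH)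
      also have "f (col M t) = col ?N t"
        using True f[OF cols[OF True]] by (intro eq_vecI) auto
      finally show ?thesis using split[OF N] by simp
    qed
  qed
  then show ?thesis using y by (metis leD)
qed

text \<open>Extend a basis of \<open>L\<close> and its image under \<open>f\<close> to bases of the
  two full spaces. There \<open>f\<close> is the start of a rectangular identity matrix, and that
  matrix defines an extension of largest possible rank. The result is stated for
  \<open>B\<^sup>T\<close> because right multiplication by \<open>B\<close> acts on rows as
  \<open>B\<^sup>T\<close>.\<close>

lemma full_rank_extension:
  fixes f :: "'a::field vec \<Rightarrow> 'a vec"
  assumes L: "subspace_vec n L"
    and f: "\<And>x. x \<in> L \<Longrightarrow> f x \<in> carrier_vec n'"
    and add: "\<And>x y. x \<in> L \<Longrightarrow> y \<in> L \<Longrightarrow> f (x + y) = f x + f y"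
    and smult: "\<And>c x. x \<in> L \<Longrightarrow> f (c \<cdot>\<^sub>v x) = c \<cdot>\<^sub>v f x"
    and inj: "\<And>x. x \<in> L \<Longrightarrow> f x = 0\<^sub>v n' \<Longrightarrow> x = 0\<^sub>v n"
  shows "\<exists>B\<in>carrier_mat n n'. Rk B = min n n' \<and> (\<forall>x\<in>L. f x = B\<^sup>T *\<^sub>v x)"
proof -
  obtain k M where M: "inj_mat n k M" "(\<lambda>y. M *\<^sub>v y) ` carrier_vec k = L"
    using ex_basis_mat[OF L] .
  have Mc: "M \<in> carrier_mat n k" using M by (simp add: inj_mat_def)
  have unit: "B *\<^sub>v unit_vec c j = col B j" if "B \<in> carrier_mat b c" "j < c" for B :: "'a mat" and b c j
    using that by (intro eq_vecI) auto
  have cols: "col M j \<in> L" if "j < k" for j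
    unfolding M(2)[symmetric] unit[OF Mc that, symmetric] by auto
  define N where "N = mat n' k (\<lambda>(i,j). f (col M j) $ i)"
  have Nc: "N \<in> carrier_mat n' k" by (simp add: N_def)
  have fM: "f (M *\<^sub>v y) = N *\<^sub>v y" if "y \<in> carrier_vec k" for y
    unfolding N_def by (rule linear_on_range[OF L Mc cols f add smult that])
  have rangeL: "M *\<^sub>v y \<in> L" if "y \<in> carrier_vec k" for y using that M(2) by blast
  \<comment> \<open>Injectivity of \<open>f\<close> on \<open>L\<close> keeps the images of the
    basis vectors independent.\<close>
  have N: "inj_mat n' k N"
    using inj[OF rangeL] M(1) Nc by (auto simp: inj_mat_def fM)
  obtain P Q where P: "P \<in> carrier_mat n n" "Q \<in> carrier_mat n n" "P * Q = 1\<^sub>m n" "Q * P = 1\<^sub>m n"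
    "\<And>j. j < k \<Longrightarrow> col P j = col M j" using extend_to_invertible[OF M(1)] by metis
  obtain R S where R: "R \<in> carrier_mat n' n'" "S \<in> carrier_mat n' n'" "R * S = 1\<^sub>m n'" "S * R = 1\<^sub>m n'"
    "\<And>j. j < k \<Longrightarrow> col R j = col N j" using extend_to_invertible[OF N] by metis
  have kn: "k \<le> n" "k \<le> n'" using inj_mat_le M(1) N by auto
  \<comment> \<open>The rectangular identity: it pads a vector with zeros or truncates it, so
    \<open>J b a\<close> undoes \<open>J a b\<close> when \<open>b \<le> a\<close>.\<close>
  define J where "J = (\<lambda>a b. mat a b (\<lambda>(i,j). if i = j then 1 else 0) :: 'a mat)"
  have Jc: "J a b \<in> carrier_mat a b" for a b by (simp add: J_def)
  have Jv: "J a b *\<^sub>v y = vec a (\<lambda>i. if i < b then y $ i else 0)" if "y \<in> carrier_vec b" for a b y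
  proof (rule eq_vecI)
    fix i assume "i < Matrix.dim_vec (vec a (\<lambda>i. if i < b then y $ i else 0))"
    then have i: "i < a" by simp
    have "(J a b *\<^sub>v y) $ i = (\<Sum>j = 0..<b. (if i = j then 1 else 0) * y $ j)"
      using i that by (auto simp: J_def scalar_prod_def)
    also have "\<dots> = (\<Sum>j = 0..<b. if i = j then y $ j else 0)"
      by (intro sum.cong) auto
    finally show "(J a b *\<^sub>v y) $ i = vec a (\<lambda>i. if i < b then y $ i else 0) $ i"
      using i by simp
  qed (simp add: J_def)
  have JJ: "J b a *\<^sub>v (J a b *\<^sub>v y) = y" if y: "y \<in> carrier_vec b" and "b \<le> a" for a b y
  proof -
    have "J b a *\<^sub>v (J a b *\<^sub>v y) = vec b (\<lambda>i. if i < a then (J a b *\<^sub>v y) $ i else 0)"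
      by (rule Jv[OF mult_mat_vec_carrier[OF Jc y]])
    also have "\<dots> = y" unfolding Jv[OF y] using that by (intro eq_vecI) auto
    finally show ?thesis .
  qed
  \<comment> \<open>Take coordinates with respect to the basis \<open>P\<close>, pad or truncate,
    and read the result in the basis \<open>R\<close>. The first \<open>k\<close> columns of
    \<open>P\<close> and \<open>R\<close> are those of \<open>M\<close> and \<open>N\<close>, so
    \<open>T\<close> agrees with \<open>f\<close> on a basis of \<open>L\<close>.\<close>
  define T where "T = R * (J n' n * Q)"
  have Tc: "T \<in> carrier_mat n' n" 
    unfolding T_def by (rule mult_carrier_mat[OF R(1) mult_carrier_mat[OF Jc P(2)]])
  have Tx: "T *\<^sub>v x = R *\<^sub>v (J n' n *\<^sub>v (Q *\<^sub>v x))" if "x \<in> carrier_vec n" for x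
  proof -
    have "J n' n * Q \<in> carrier_mat n' n" using Jc P(2) by (rule mult_carrier_mat)
    then show ?thesis unfolding T_def
      using assoc_mult_mat_vec[OF R(1) _ that] assoc_mult_mat_vec[OF Jc P(2) that] by simp
  qed
  have fT: "f x = T *\<^sub>v x" if x: "x \<in> L" for x
  proof -
    obtain y where y: "y \<in> carrier_vec k" "x = M *\<^sub>v y" using x M(2) by blast
    have "f (col M j) = T *\<^sub>v col M j" if j: "j < k" for j
    proof -
      have "col M j = P *\<^sub>v unit_vec n j" using unit[OF P(1)] P(5) j kn by simp
      then have "Q *\<^sub>v col M j = unit_vec n j"
        using assoc_mult_mat_vec[OF P(2,1), of "unit_vec n j"] P(4) by simp
      then have "T *\<^sub>v col M j = R *\<^sub>v (J n' n *\<^sub>v unit_vec n j)"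
        using Tx[of "col M j"] L cols[OF j] by (auto simp: subspace_vec_iff)
      also have "J n' n *\<^sub>v unit_vec n j = unit_vec n' j"
        using j kn by (subst Jv) (auto intro!: eq_vecI)
      also have "R *\<^sub>v unit_vec n' j = col N j" using unit[OF R(1)] R(5) j kn by simp
      also have "\<dots> = f (col M j)"
        using j f[OF cols[OF j]] by (intro eq_vecI) (auto simp: N_def)
      finally show ?thesis by simp
    qed
    then have "N = mat n' k (\<lambda>(i,j). (T *\<^sub>v col M j) $ i)"
      unfolding N_def by (intro eq_matI) auto
    moreover have "T *\<^sub>v (M *\<^sub>v y) = mat n' k (\<lambda>(i,j). (T *\<^sub>v col M j) $ i) *\<^sub>v y"
    proof (rule linear_on_range[OF L Mc cols _ _ _ y(1)])
      have "L \<subseteq> carrier_vec n" using L by (simp add: subspace_vec_iff)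
      then show "x \<in> L \<Longrightarrow> T *\<^sub>v x \<in> carrier_vec n'"
        and "x \<in> L \<Longrightarrow> y \<in> L \<Longrightarrow> T *\<^sub>v (x + y) = T *\<^sub>v x + T *\<^sub>v y"
        and "x \<in> L \<Longrightarrow> T *\<^sub>v (c \<cdot>\<^sub>v x) = c \<cdot>\<^sub>v (T *\<^sub>v x)" for x y c
        using mult_add_distrib_mat_vec[OF Tc] mult_mat_vec[OF Tc] Tc
        by (simp_all add: subset_iff)
    qed
    ultimately show ?thesis using fM y by simp
  qed
  \<comment> \<open>Like the rectangular identity, \<open>T\<close> is injective for
    \<open>n \<le> n'\<close> and onto otherwise.\<close>
  have "dim_vec n' ((\<lambda>x. T *\<^sub>v x) ` carrier_vec n) = min n n'"
  proof (cases "n \<le> n'")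
    case True
    have "inj_mat n' n T" unfolding inj_mat_def
    proof (intro conjI ballI impI Tc)
      fix x :: "'a vec" assume x: "x \<in> carrier_vec n" "T *\<^sub>v x = 0\<^sub>v n'"
      have Qx: "Q *\<^sub>v x \<in> carrier_vec n" using P(2) x by simp
      then have JQ: "J n' n *\<^sub>v (Q *\<^sub>v x) \<in> carrier_vec n'" using mult_mat_vec_carrier[OF Jc] by blast
      then have "J n' n *\<^sub>v (Q *\<^sub>v x) = 0\<^sub>v n'"
        using inj_mat_left_inverse[OF R(1,2,4)] x Tx by (simp add: inj_mat_def)
      then have "Q *\<^sub>v x = 0\<^sub>v n"
        using JJ[OF Qx True] mult_mat_zero_vec[OF Jc] by simp
      then show "x = 0\<^sub>v n" using inj_mat_left_inverse[OF P(2,1,3)] x by (simp add: inj_mat_def)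
    qed
    then show ?thesis using dim_vec_range_inj_mat True by simp
  next
    case False
    have "z \<in> (\<lambda>x. T *\<^sub>v x) ` carrier_vec n" if z: "z \<in> carrier_vec n'" for z
    proof -
      define x where "x = P *\<^sub>v (J n n' *\<^sub>v (S *\<^sub>v z))"
      have Sz: "S *\<^sub>v z \<in> carrier_vec n'" using R(2) z by simp
      have JS: "J n n' *\<^sub>v (S *\<^sub>v z) \<in> carrier_vec n" using mult_mat_vec_carrier[OF Jc Sz] .
      have "Q *\<^sub>v x = J n n' *\<^sub>v (S *\<^sub>v z)"
        using assoc_mult_mat_vec[OF P(2,1) JS] P(4) JS by (simp add: x_def)
      then have "J n' n *\<^sub>v (Q *\<^sub>v x) = S *\<^sub>v z" using JJ[OF Sz] False by simp
      moreover have "x \<in> carrier_vec n" using P(1) JS by (simp add: x_def)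
      ultimately have "T *\<^sub>v x = z"
        using Tx assoc_mult_mat_vec[OF R(1,2) z] R(3) z by simp
      then show ?thesis using \<open>x \<in> carrier_vec n\<close> by blast
    qed
    then have "(\<lambda>x. T *\<^sub>v x) ` carrier_vec n = carrier_vec n'" using Tc by auto
    then show ?thesis using False dim_vec_carrier by simp
  qed
  then have "Rk (T\<^sup>T) = min n n'" using Row_eq_image[of "T\<^sup>T" n n'] Tc by (simp add: Rk_def)
  then show ?thesis using Tc fT by (intro bexI[of _ "T\<^sup>T"]) auto
qed

section \<open>Rank-one matrices\<close>

definition outer :: "'a::field vec \<Rightarrow> 'a vec \<Rightarrow> 'a mat" where
  "outer u v = mat (Matrix.dim_vec u) (Matrix.dim_vec v) (\<lambda>(i,j). u $ i * v $ j)"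

lemma outer_carrier [simp]:
  "u \<in> carrier_vec m \<Longrightarrow> v \<in> carrier_vec n \<Longrightarrow> outer u v \<in> carrier_mat m n"
  by (auto simp: outer_def)

lemma index_outer [simp]:
  "i < Matrix.dim_vec u \<Longrightarrow> j < Matrix.dim_vec v \<Longrightarrow> outer u v $$ (i,j) = u $ i * v $ j"
  by (simp add: outer_def)

lemma dim_outer [simp]:
  "dim_row (outer u v) = Matrix.dim_vec u" "dim_col (outer u v) = Matrix.dim_vec v"
  by (simp_all add: outer_def)

lemma row_outer [simp]: "i < Matrix.dim_vec u \<Longrightarrow> row (outer u v) i = u $ i \<cdot>\<^sub>v v"
  by (intro eq_vecI) auto

lemma outer_add_left:
  "u \<in> carrier_vec m \<Longrightarrow> u' \<in> carrier_vec m \<Longrightarrow> outer (u + u') v = outer u v + outer u' v"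
  by (intro eq_matI) (auto simp: distrib_right)

lemma outer_add_right:
  "v \<in> carrier_vec m \<Longrightarrow> v' \<in> carrier_vec m \<Longrightarrow> outer u (v + v') = outer u v + outer u v'"
  by (intro eq_matI) (auto simp: distrib_left)

lemma outer_smult_left: "outer (c \<cdot>\<^sub>v u) v = c \<cdot>\<^sub>m outer u v"
  by (intro eq_matI) auto

lemma outer_smult_right: "outer u (c \<cdot>\<^sub>v v) = c \<cdot>\<^sub>m outer u v"
  by (intro eq_matI) auto

lemma outer_zero_left [simp]: "v \<in> carrier_vec n \<Longrightarrow> outer (0\<^sub>v m) v = 0\<^sub>m m n"
  by (intro eq_matI) auto

lemma outer_zero_right [simp]: "u \<in> carrier_vec m \<Longrightarrow> outer u (0\<^sub>v n) = 0\<^sub>m m n"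
  by (intro eq_matI) auto

lemma transpose_outer: "(outer u v)\<^sup>T = outer v u"
  by (intro eq_matI) auto

lemma nonzero_entry:
  assumes "v \<in> carrier_vec n" "v \<noteq> 0\<^sub>v n"
  obtains i where "i < n" "v $ i \<noteq> 0"
  using assms eq_vecI[of v "0\<^sub>v n"] by auto

lemma nonzero_row:
  assumes C: "C \<in> carrier_mat m n" and nz: "C \<noteq> 0\<^sub>m m n"
  obtains i where "i < m" "row C i \<noteq> 0\<^sub>v n"
proof -
  have "\<exists>i<m. row C i \<noteq> 0\<^sub>v n"
  proof (rule ccontr)
    assume "\<not> (\<exists>i<m. row C i \<noteq> 0\<^sub>v n)"
    then have "C = 0\<^sub>m m n" using C by (intro eq_rowI) auto
    then show False using nz by simp
  qed
  then show ?thesis using that by blast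
qed

lemma outer_right_cancel:
  assumes eq: "outer a w = outer b w"
    and c: "a \<in> carrier_vec m" "b \<in> carrier_vec m" "w \<in> carrier_vec n" "w \<noteq> 0\<^sub>v n"
  shows "a = b"
proof -
  obtain t where t: "t < n" "w $ t \<noteq> 0" using nonzero_entry[OF c(3,4)] .
  have "a $ i * w $ t = b $ i * w $ t" if "i < m" for i
    using arg_cong[OF eq, of "\<lambda>C. C $$ (i,t)"] that t c by simp
  then show ?thesis using t c by (intro eq_vecI) auto
qed

lemma outer_left_cancel:
  assumes eq: "outer w a = outer w b"
    and c: "a \<in> carrier_vec n" "b \<in> carrier_vec n" "w \<in> carrier_vec m" "w \<noteq> 0\<^sub>v m"
  shows "a = b"
  using outer_right_cancel[of a w b n m] arg_cong[OF eq, of transpose_mat] c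
  by (simp add: transpose_outer)

lemma outer_eq_zero:
  assumes "outer u v = 0\<^sub>m m n" "u \<in> carrier_vec m" "v \<in> carrier_vec n" "u \<noteq> 0\<^sub>v m"
  shows "v = 0\<^sub>v n"
  using outer_left_cancel[of u v "0\<^sub>v n" n m] assms by simp

lemma mult_outer_left:
  assumes "A \<in> carrier_mat k m" "u \<in> carrier_vec m"
  shows "A * outer u v = outer (A *\<^sub>v u) v"
  using assms by (intro eq_matI) (auto simp: scalar_prod_def sum_distrib_right mult.assoc)

lemma mult_outer_right:
  assumes "B \<in> carrier_mat n k" "v \<in> carrier_vec n"
  shows "outer u v * B = outer u (B\<^sup>T *\<^sub>v v)"
  using assms by (intro eq_matI) (auto simp: scalar_prod_def sum_distrib_left ac_simps)

lemma mult_outer: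
  assumes "A \<in> carrier_mat k m" "u \<in> carrier_vec m" "B \<in> carrier_mat n l" "v \<in> carrier_vec n"
  shows "A * outer u v * B = outer (A *\<^sub>v u) (B\<^sup>T *\<^sub>v v)"
  using mult_outer_left[of A k m u v] mult_outer_right[of B n l v "A *\<^sub>v u"] assms by simp

lemma rows_in_line:
  assumes C: "C \<in> carrier_mat m n" and w: "w \<in> carrier_vec n" and rows: "\<And>i. i < m \<Longrightarrow> row C i \<in> line w"
  obtains u where "u \<in> carrier_vec m" "C = outer u w"
proof -
  have "\<forall>i. \<exists>c. i < m \<longrightarrow> row C i = c \<cdot>\<^sub>v w" using rows unfolding line_def by blast
  then obtain c where c: "\<And>i. i < m \<Longrightarrow> row C i = c i \<cdot>\<^sub>v w" by metis
  have "C = outer (vec m c) w"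
    using C w c by (intro eq_rowI) auto
  then show ?thesis using that[of "vec m c"] by simp
qed

lemma outer_in_VL:
  assumes "subspace_vec n L" "u \<in> carrier_vec m" "v \<in> L"
  shows "outer u v \<in> VL m n L"
  using assms by (auto simp: VL_eq subspace_vec_iff)

section \<open>Subspaces and row spaces under matrices\<close>

lemma subspace_image:
  assumes "subspace_vec n S" and N: "N \<in> carrier_mat n' n"
  shows "subspace_vec n' ((\<lambda>x. N *\<^sub>v x) ` S)"
proof -
  have S: "S \<subseteq> carrier_vec n" "0\<^sub>v n \<in> S" "\<And>x y. x \<in> S \<Longrightarrow> y \<in> S \<Longrightarrow> x + y \<in> S"
    "\<And>c x. x \<in> S \<Longrightarrow> c \<cdot>\<^sub>v x \<in> S"
    using assms(1) by (auto simp: subspace_vec_iff)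
  have "N *\<^sub>v 0\<^sub>v n = 0\<^sub>v n'" using N by (rule mult_mat_zero_vec)
  then have "0\<^sub>v n' \<in> (\<lambda>x. N *\<^sub>v x) ` S" using S(2) by (metis imageI)
  moreover have "N *\<^sub>v x + N *\<^sub>v y \<in> (\<lambda>x. N *\<^sub>v x) ` S" if "x \<in> S" "y \<in> S" for x y
    using that S mult_add_distrib_mat_vec[OF N, of x y] by (metis imageI subset_iff)
  moreover have "c \<cdot>\<^sub>v (N *\<^sub>v x) \<in> (\<lambda>x. N *\<^sub>v x) ` S" if "x \<in> S" for c x
    using that S mult_mat_vec[OF N, of x c] by (metis imageI subset_iff)
  moreover have "(\<lambda>x. N *\<^sub>v x) ` S \<subseteq> carrier_vec n'" using N S(1) by (auto simp: subset_iff)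
  ultimately show ?thesis by (auto simp: subspace_vec_iff)
qed

lemma subspace_vimage:
  assumes "subspace_vec n L" "subspace_vec n' S" and N: "N \<in> carrier_mat n' n"
  shows "subspace_vec n {x \<in> L. N *\<^sub>v x \<in> S}"
  using assms mult_add_distrib_mat_vec[OF N] mult_mat_vec[OF N]
  by (auto simp: subspace_vec_iff subset_iff mult_mat_zero_vec[OF N])

text \<open>The transpose of \<open>A\<close> is onto, so multiplying by \<open>A\<close> only
  reparametrizes the combinations of rows, while \<open>B\<close> moves each row by
  \<open>B\<^sup>T\<close>.\<close>

lemma Row_mult:
  assumes A: "A \<in> carrier_mat m m" and Q: "Q \<in> carrier_mat m m" and AQ: "A * Q = 1\<^sub>m m" "Q * A = 1\<^sub>m m"
    and C: "C \<in> carrier_mat m n" and B: "B \<in> carrier_mat n n'"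
  shows "Row (A * C * B) = (\<lambda>x. B\<^sup>T *\<^sub>v x) ` Row C"
proof -
  have QA: "A\<^sup>T * Q\<^sup>T = 1\<^sub>m m" using transpose_mult[OF Q A] AQ by simp
  have surj: "(\<lambda>y. A\<^sup>T *\<^sub>v y) ` carrier_vec m = carrier_vec m"
  proof (intro equalityI subsetI)
    fix y :: "'a vec" assume y: "y \<in> carrier_vec m"
    then have "y = A\<^sup>T *\<^sub>v (Q\<^sup>T *\<^sub>v y)"
      using assoc_mult_mat_vec[of "A\<^sup>T" m m "Q\<^sup>T" m y] A Q QA by simp
    then show "y \<in> (\<lambda>y. A\<^sup>T *\<^sub>v y) ` carrier_vec m" using Q y by fastforce
  qed (use A in auto)
  have T: "(A * C * B)\<^sup>T *\<^sub>v y = B\<^sup>T *\<^sub>v (C\<^sup>T *\<^sub>v (A\<^sup>T *\<^sub>v y))" if y: "y \<in> carrier_vec m" for y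
  proof -
    have "(A * C * B)\<^sup>T = B\<^sup>T * (C\<^sup>T * A\<^sup>T)"
      using transpose_mult[of "A * C" m n B n'] transpose_mult[OF A C] A B C by simp
    moreover have "B\<^sup>T * (C\<^sup>T * A\<^sup>T) *\<^sub>v y = B\<^sup>T *\<^sub>v ((C\<^sup>T * A\<^sup>T) *\<^sub>v y)"
      using assoc_mult_mat_vec[of "B\<^sup>T" n' n "C\<^sup>T * A\<^sup>T" m y] A B C y by simp
    moreover have "(C\<^sup>T * A\<^sup>T) *\<^sub>v y = C\<^sup>T *\<^sub>v (A\<^sup>T *\<^sub>v y)"
      using assoc_mult_mat_vec[of "C\<^sup>T" n m "A\<^sup>T" m y] A C y by simp
    ultimately show ?thesis by simp
  qed
  have "Row (A * C * B) = (\<lambda>y. (A * C * B)\<^sup>T *\<^sub>v y) ` carrier_vec m"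
    using A B C by (intro Row_eq_image) auto
  also have "\<dots> = (\<lambda>y. B\<^sup>T *\<^sub>v (C\<^sup>T *\<^sub>v (A\<^sup>T *\<^sub>v y))) ` carrier_vec m"
    using T by (intro image_cong) auto
  also have "\<dots> = (\<lambda>x. B\<^sup>T *\<^sub>v x) ` (\<lambda>y. C\<^sup>T *\<^sub>v y) ` (\<lambda>y. A\<^sup>T *\<^sub>v y) ` carrier_vec m"
    by (simp add: image_image)
  finally show ?thesis using surj Row_eq_image[OF C] by simp
qed

section \<open>Isomorphisms of rank support spaces\<close>

text \<open>Linearity is required on \<open>VL m n L\<close> only: \<open>\<phi>\<close> is a total
  function whose values outside the domain are arbitrary.\<close>

locale rank_support_iso =
  fixes m n n' :: nat and L L' :: "'a::field vec set" and \<phi> :: "'a mat \<Rightarrow> 'a mat"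
  assumes L: "subspace_vec n L" and L': "subspace_vec n' L'"
    and add: "\<And>C D. C \<in> VL m n L \<Longrightarrow> D \<in> VL m n L \<Longrightarrow> \<phi> (C + D) = \<phi> C + \<phi> D"
    and smult: "\<And>a C. C \<in> VL m n L \<Longrightarrow> \<phi> (a \<cdot>\<^sub>m C) = a \<cdot>\<^sub>m \<phi> C"
    and bij: "bij_betw \<phi> (VL m n L) (VL m n' L')"
begin

lemma L_carrier: "x \<in> L \<Longrightarrow> x \<in> carrier_vec n"
  using L by (auto simp: subspace_vec_iff)

lemma maps: "C \<in> VL m n L \<Longrightarrow> \<phi> C \<in> VL m n' L'"
  using bij by (auto simp: bij_betw_def)

lemma maps_carrier: "C \<in> VL m n L \<Longrightarrow> \<phi> C \<in> carrier_mat m n'"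
  using maps by (auto simp: VL_def)

lemma inj: "C \<in> VL m n L \<Longrightarrow> D \<in> VL m n L \<Longrightarrow> \<phi> C = \<phi> D \<Longrightarrow> C = D"
  using bij by (auto simp: bij_betw_def inj_on_def)

lemma zero_in: "0\<^sub>m m n \<in> VL m n L"
  using subspace_VL[OF L] by (simp add: subspace_mat_iff)

lemma zero: "\<phi> (0\<^sub>m m n) = 0\<^sub>m m n'"
proof -
  have "\<phi> (0\<^sub>m m n) = \<phi> (0 \<cdot>\<^sub>m 0\<^sub>m m n)" by simp
  also have "\<dots> = 0 \<cdot>\<^sub>m \<phi> (0\<^sub>m m n)" by (rule smult[OF zero_in])
  also have "\<dots> = 0\<^sub>m m n'" using maps_carrier[OF zero_in] by auto
  finally show ?thesis .
qed

lemma outer_in: "u \<in> carrier_vec m \<Longrightarrow> v \<in> L \<Longrightarrow> outer u v \<in> VL m n L"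
  using outer_in_VL[OF L] .

text \<open>\<open>C\<close> is the sum over \<open>i\<close> of the rank-one matrices
  \<open>outer (unit_vec m i) (row C i)\<close>, and each summand lies in \<open>VL m n L\<close>
  because its row factor lies in \<open>L\<close>.\<close>

lemma factorization_if_outer:
  assumes A: "A \<in> carrier_mat m m" and B: "B \<in> carrier_mat n n'"
    and outer: "\<And>u v. u \<in> carrier_vec m \<Longrightarrow> v \<in> L \<Longrightarrow> \<phi> (outer u v) = A * outer u v * B"
    and C: "C \<in> VL m n L"
  shows "\<phi> C = A * C * B"
proof -
  have Cc: "C \<in> carrier_mat m n" and rows: "\<And>i. i < m \<Longrightarrow> row C i \<in> L"
    using C by (auto simp: VL_eq[OF L])
  \<comment> \<open>The partial sums: \<open>T t\<close> keeps the first \<open>t\<close> rows, so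
    passing to \<open>Suc t\<close> adds the row with index \<open>t\<close>.\<close>
  define T where "T = (\<lambda>t. mat m n (\<lambda>(i,j). if i < t then C $$ (i,j) else 0))"
  have "T t \<in> VL m n L \<and> \<phi> (T t) = A * T t * B" if "t \<le> m" for t
    using that
  proof (induction t)
    case 0
    have "T 0 = 0\<^sub>m m n" by (auto simp: T_def)
    then show ?case using zero zero_in A B by simp
  next
    case (Suc t)
    let ?O = "outer (unit_vec m t) (row C t)"
    have O: "?O \<in> VL m n L" using Suc.prems rows by (intro outer_in) auto
    have Oc: "?O \<in> carrier_mat m n" using O by (simp add: VL_def)
    have Tc: "T t \<in> carrier_mat m n" by (simp add: T_def)
    have eq: "T (Suc t) = T t + ?O"
      using Cc Suc.prems by (intro eq_matI) (auto simp: T_def less_Suc_eq)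
    have "A * (T t + ?O) * B = A * T t * B + A * ?O * B"
      unfolding mult_add_distrib_mat[OF A Tc Oc]
      by (rule add_mult_distrib_mat[OF mult_carrier_mat[OF A Tc] mult_carrier_mat[OF A Oc] B])
    moreover have "T t + ?O \<in> VL m n L"
      using Suc O subspace_VL[OF L] by (auto simp: subspace_mat_iff)
    ultimately show ?case using Suc O rows unfolding eq
      by (simp add: add outer)
  qed
  moreover have "T m = C" using Cc by (auto simp: T_def)
  ultimately show ?thesis by (metis order_refl)
qed

text \<open>The order of the quantifiers is the content: \<open>w\<close> may depend on
  \<open>v\<close> but not on \<open>u\<close>.\<close>

definition preserves_lines :: bool where
  "preserves_lines \<longleftrightarrow> (\<forall>v\<in>L. \<exists>w\<in>carrier_vec n'. \<forall>u\<in>carrier_vec m. \<exists>u'\<in>carrier_vec m.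
     \<phi> (outer u v) = outer u' w)"

section \<open>From preserved lines to a factorization\<close>

lemma factorization_if_preserves_lines:
  assumes "preserves_lines"
  shows "\<exists>A\<in>carrier_mat m m. \<exists>B\<in>carrier_mat n n'.
    Rk A = m \<and> Rk B = min n n' \<and> (\<forall>C\<in>VL m n L. \<phi> C = A * C * B)"
proof (cases "m = 0 \<or> L \<subseteq> {0\<^sub>v n}")
  case True
  \<comment> \<open>Here the domain of \<open>\<phi>\<close> is zero, and any matrices of full rank
    will do. One for \<open>B\<close> comes from extending the zero map on the zero space.\<close>
  obtain B :: "'a mat" where B: "B \<in> carrier_mat n n'" "Rk B = min n n'"
    using full_rank_extension[of n "{0\<^sub>v n}" "\<lambda>_. 0\<^sub>v n'" n'] by (auto simp: subspace_vec_iff)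
  have "C = 0\<^sub>m m n" if "C \<in> VL m n L" for C
  proof (rule eq_rowI)
    fix i assume "i < dim_row (0\<^sub>m m n :: 'a mat)"
    then show "row C i = row (0\<^sub>m m n) i" using that True by (auto simp: VL_eq[OF L])
  qed (use that in \<open>auto simp: VL_def\<close>)
  moreover have "\<phi> (0\<^sub>m m n) = 1\<^sub>m m * 0\<^sub>m m n * B" using zero B by simp
  ultimately have "\<forall>C\<in>VL m n L. \<phi> C = 1\<^sub>m m * C * B" by metis
  moreover have "Rk (1\<^sub>m m :: 'a mat) = m" by (rule Rk_invertible[of _ _ "1\<^sub>m m"]) auto
  ultimately show ?thesis using B one_carrier_mat by blast
next
  case False
  have H: "\<exists>w\<in>carrier_vec n'. \<forall>u\<in>carrier_vec m. \<exists>u'\<in>carrier_vec m. \<phi> (outer u v) = outer u' w"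
    if "v \<in> L" for v
    using assms that by (simp add: preserves_lines_def)
  from False obtain v0 where v0: "v0 \<in> L" "v0 \<noteq> 0\<^sub>v n" and m: "0 < m" by auto
  \<comment> \<open>A nonzero test vector; as its entry at \<open>0\<close> is \<open>1\<close>, row
    \<open>0\<close> of \<open>outer e v\<close> is \<open>v\<close> itself.\<close>
  define e where "e = (unit_vec m 0 :: 'a vec)"
  have e: "e \<in> carrier_vec m" "e \<noteq> 0\<^sub>v m" "e $ 0 = 1"
    using m by (auto simp: e_def)
  have nonzero: "\<phi> (outer u v) \<noteq> 0\<^sub>m m n'" if "u \<in> carrier_vec m" "u \<noteq> 0\<^sub>v m" "v \<in> L" "v \<noteq> 0\<^sub>v n" for u v
    using that inj[OF outer_in zero_in, of u v] zero outer_eq_zero[of u v m n] L_carrier by auto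
  obtain w0 where w0: "w0 \<in> carrier_vec n'"
    and "\<forall>u\<in>carrier_vec m. \<exists>u'\<in>carrier_vec m. \<phi> (outer u v0) = outer u' w0"
    using H[OF v0(1)] by blast
  then obtain g where g: "\<And>u. u \<in> carrier_vec m \<Longrightarrow> g u \<in> carrier_vec m"
    "\<And>u. u \<in> carrier_vec m \<Longrightarrow> \<phi> (outer u v0) = outer (g u) w0" by metis
  have w0nz: "w0 \<noteq> 0\<^sub>v n'" using nonzero[OF e(1,2) v0] g[OF e(1)] by auto
  \<comment> \<open>Cancelling the nonzero factor \<open>w0\<close> makes \<open>g\<close> linear;
    \<open>A\<close> is its matrix, with the values at the unit vectors as columns.\<close>
  define A where "A = mat m m (\<lambda>(i,j). g (col (1\<^sub>m m) j) $ i)"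
  have A: "A \<in> carrier_mat m m" by (simp add: A_def)
  have gA: "g u = A *\<^sub>v u" if u: "u \<in> carrier_vec m" for u
  proof -
    have "g (1\<^sub>m m *\<^sub>v u) = A *\<^sub>v u" unfolding A_def
    proof (rule linear_on_range[OF subspace_vec_carrier _ _ g(1) _ _ u])
      fix x y :: "'a vec" assume xy: "x \<in> carrier_vec m" "y \<in> carrier_vec m"
      have "outer (g (x + y)) w0 = \<phi> (outer x v0 + outer y v0)"
        using g(2)[of "x + y"] xy outer_add_left[of x m y v0] by simp
      also have "\<dots> = outer (g x + g y) w0"
        using xy v0 outer_in g outer_add_left[of "g x" m "g y" w0] by (simp add: add)
      finally show "g (x + y) = g x + g y"
        using outer_right_cancel[of _ w0 _ m n'] w0 w0nz g xy by simp
    next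
      fix c and x :: "'a vec" assume x: "x \<in> carrier_vec m"
      have "outer (g (c \<cdot>\<^sub>v x)) w0 = \<phi> (c \<cdot>\<^sub>m outer x v0)"
        using g(2)[of "c \<cdot>\<^sub>v x"] x by (simp add: outer_smult_left)
      also have "\<dots> = outer (c \<cdot>\<^sub>v g x) w0"
        using x v0 outer_in g by (simp add: smult outer_smult_left)
      finally show "g (c \<cdot>\<^sub>v x) = c \<cdot>\<^sub>v g x"
        using outer_right_cancel[of _ w0 _ m n'] w0 w0nz g x by simp
    qed auto
    then show ?thesis using u by simp
  qed
  have phi0: "\<phi> (outer u v0) = outer (A *\<^sub>v u) w0" if "u \<in> carrier_vec m" for u
    using g(2)[OF that] gA[OF that] by simp
  have Anz: "u = 0\<^sub>v m" if "u \<in> carrier_vec m" "A *\<^sub>v u = 0\<^sub>v m" for u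
    using nonzero[OF that(1) _ v0] phi0[OF that(1)] that(2) w0 by auto
  then have "inj_mat m m A" using A by (auto simp: inj_mat_def)
  then obtain Q where Q: "Q \<in> carrier_mat m m" "A * Q = 1\<^sub>m m" "Q * A = 1\<^sub>m m"
    by (rule inj_mat_square)
  have "\<exists>f\<in>carrier_vec n'. \<forall>u\<in>carrier_vec m. \<phi> (outer u v) = outer (A *\<^sub>v u) f" if v: "v \<in> L" for v
  proof (cases "v \<in> line v0")
    case True
    then obtain c where "v = c \<cdot>\<^sub>v v0" by (auto simp: line_def)
    then show ?thesis
      using phi0 w0 v0 outer_in by (intro bexI[of _ "c \<cdot>\<^sub>v w0"]) (auto simp: outer_smult_right smult)
  next
    case False
    obtain w where w: "w \<in> carrier_vec n'"
      and "\<forall>u\<in>carrier_vec m. \<exists>u'\<in>carrier_vec m. \<phi> (outer u v) = outer u' w"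
      using H[OF v] by blast
    then obtain a where a: "\<And>u. u \<in> carrier_vec m \<Longrightarrow> a u \<in> carrier_vec m"
      "\<And>u. u \<in> carrier_vec m \<Longrightarrow> \<phi> (outer u v) = outer (a u) w" by metis
    \<comment> \<open>The sum ties the column map \<open>a\<close> of \<open>v\<close> to the column
      map \<open>A\<close> of \<open>v0\<close>, which so far are unrelated.\<close>
    have vv: "v0 + v \<in> L" using v v0 L by (simp add: subspace_vec_iff)
    obtain w' where w': "w' \<in> carrier_vec n'"
      and "\<forall>u\<in>carrier_vec m. \<exists>u'\<in>carrier_vec m. \<phi> (outer u (v0 + v)) = outer u' w'"
      using H[OF vv] by blast
    then obtain b where b: "\<And>u. u \<in> carrier_vec m \<Longrightarrow> b u \<in> carrier_vec m"
      "\<And>u. u \<in> carrier_vec m \<Longrightarrow> \<phi> (outer u (v0 + v)) = outer (b u) w'" by metis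
    \<comment> \<open>Otherwise, \<open>A\<close> being onto, \<open>\<phi> (outer e v)\<close>
      would also be the image of some \<open>outer u v0\<close>, and injectivity would put
      \<open>v\<close> on the line of \<open>v0\<close>. Hence \<open>w0\<close> and
      \<open>w\<close> are independent.\<close>
    have "w \<noteq> \<gamma> \<cdot>\<^sub>v w0" for \<gamma>
    proof
      assume "w = \<gamma> \<cdot>\<^sub>v w0"
      then have "\<phi> (outer e v) = outer (\<gamma> \<cdot>\<^sub>v a e) w0"
        using a(2)[OF e(1)] by (simp add: outer_smult_left outer_smult_right)
      also have "\<gamma> \<cdot>\<^sub>v a e = A *\<^sub>v (Q *\<^sub>v (\<gamma> \<cdot>\<^sub>v a e))"
        using assoc_mult_mat_vec[OF A Q(1), of "\<gamma> \<cdot>\<^sub>v a e"] Q(2) a(1)[OF e(1)] by simp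
      also have "outer \<dots> w0 = \<phi> (outer (Q *\<^sub>v (\<gamma> \<cdot>\<^sub>v a e)) v0)"
        using phi0[of "Q *\<^sub>v (\<gamma> \<cdot>\<^sub>v a e)"] a(1)[OF e(1)] Q(1) by simp
      finally have "outer e v = outer (Q *\<^sub>v (\<gamma> \<cdot>\<^sub>v a e)) v0"
        using inj[OF outer_in outer_in] e v v0 a(1)[OF e(1)] Q(1) by simp
      from arg_cong[OF this, of "\<lambda>C. row C 0"] have "v = (Q *\<^sub>v (\<gamma> \<cdot>\<^sub>v a e)) $ 0 \<cdot>\<^sub>v v0"
        using e m Q(1) by simp
      then show False using False by simp
    qed
    note wline = this
    have indep: "\<alpha> = 0 \<and> \<beta> = 0"
      if z: "\<And>j. j < n' \<Longrightarrow> \<alpha> * w0 $ j + \<beta> * w $ j = 0" for \<alpha> \<beta>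
    proof -
      have "\<beta> = 0"
      proof (rule ccontr)
        assume "\<beta> \<noteq> 0"
        then have "w = (- \<alpha> / \<beta>) \<cdot>\<^sub>v w0"
          using z w w0 by (intro eq_vecI) (auto simp: field_simps eq_neg_iff_add_eq_0)
        then show False using wline by blast
      qed
      moreover obtain t where "t < n'" "w0 $ t \<noteq> 0" using nonzero_entry[OF w0 w0nz] .
      ultimately show ?thesis using z[of t] by simp
    qed
    have rel: "b u $ i * w' $ j = (A *\<^sub>v u) $ i * w0 $ j + a u $ i * w $ j"
      if "u \<in> carrier_vec m" "i < m" "j < n'" for u i j
    proof -
      have "outer (b u) w' = outer (A *\<^sub>v u) w0 + outer (a u) w"
        using b(2)[OF that(1)] a(2)[OF that(1)] phi0[OF that(1)] that(1) v v0 outer_in L_carrier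
        by (simp add: outer_add_right[of v0 n v] add)
      from arg_cong[OF this, of "\<lambda>C. C $$ (i,j)"] show ?thesis
        using that a(1)[OF that(1)] b(1)[OF that(1)] w w' w0 A by (simp del: index_mult_mat_vec)
    qed
    obtain i where i: "i < m" "(A *\<^sub>v e) $ i \<noteq> 0"
      using nonzero_entry[of "A *\<^sub>v e" m] Anz[OF e(1)] e A by (auto simp del: index_mult_mat_vec)
    \<comment> \<open>If this entry were zero, row \<open>i\<close> of the relation would be a
      vanishing combination of \<open>w0\<close> and \<open>w\<close> with nonzero first
      coefficient.\<close>
    have bi: "b e $ i \<noteq> 0"
      using indep[of "(A *\<^sub>v e) $ i" "a e $ i"] rel[OF e(1) i(1)] i(2) by auto
    \<comment> \<open>These are the coordinates of \<open>w'\<close> in terms of \<open>w0\<close>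
      and \<open>w\<close>, read off from a single row at \<open>e\<close>. Since \<open>w'\<close>
      does not depend on \<open>u\<close>, comparing coefficients in every row and for every
      \<open>u\<close> gives \<open>a u\<close> as the fixed multiple
      \<open>\<beta> / \<alpha>\<close> of \<open>A *\<^sub>v u\<close>.\<close>
    define \<alpha> \<beta> where "\<alpha> = (A *\<^sub>v e) $ i / b e $ i" and "\<beta> = a e $ i / b e $ i"
    have \<alpha>: "\<alpha> \<noteq> 0" using i bi by (simp add: \<alpha>_def)
    have w'eq: "w' $ j = \<alpha> * w0 $ j + \<beta> * w $ j" if "j < n'" for j
      using rel[OF e(1) i(1) that] bi by (simp add: \<alpha>_def \<beta>_def field_simps)
    have "a u = (\<beta> / \<alpha>) \<cdot>\<^sub>v (A *\<^sub>v u)" if u: "u \<in> carrier_vec m" for u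
    proof (rule eq_vecI)
      fix k assume "k < Matrix.dim_vec ((\<beta> / \<alpha>) \<cdot>\<^sub>v (A *\<^sub>v u))"
      then have k: "k < m" using A by simp
      have "(b u $ k * \<alpha> - (A *\<^sub>v u) $ k) * w0 $ j + (b u $ k * \<beta> - a u $ k) * w $ j = 0" if "j < n'" for j
        using rel[OF u k that] w'eq[OF that] by (simp add: algebra_simps)
      from indep[OF this] have "b u $ k * \<alpha> = (A *\<^sub>v u) $ k" "b u $ k * \<beta> = a u $ k"
        by auto
      then have "a u $ k = (\<beta> / \<alpha>) * (A *\<^sub>v u) $ k" using \<alpha> by (metis (no_types, opaque_lifting)
            mult.commute nonzero_mult_div_cancel_right times_divide_eq_left mult.assoc)
      then show "a u $ k = ((\<beta> / \<alpha>) \<cdot>\<^sub>v (A *\<^sub>v u)) $ k" using k A by simp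
    qed (use a(1)[OF u] A in auto)
    then have "\<phi> (outer u v) = outer (A *\<^sub>v u) ((\<beta> / \<alpha>) \<cdot>\<^sub>v w)" if "u \<in> carrier_vec m" for u
      using a(2)[OF that] that by (simp add: outer_smult_left outer_smult_right)
    then show ?thesis using w by (intro bexI[of _ "(\<beta> / \<alpha>) \<cdot>\<^sub>v w"]) auto
  qed
  then obtain f where f: "\<And>v. v \<in> L \<Longrightarrow> f v \<in> carrier_vec n'"
    "\<And>u v. u \<in> carrier_vec m \<Longrightarrow> v \<in> L \<Longrightarrow> \<phi> (outer u v) = outer (A *\<^sub>v u) (f v)" by metis
  \<comment> \<open>Cancelling this nonzero column factor carries linearity and injectivity over
    from \<open>\<phi>\<close> to \<open>f\<close>.\<close>
  have Ae: "A *\<^sub>v e \<in> carrier_vec m" "A *\<^sub>v e \<noteq> 0\<^sub>v m" using A Anz e by auto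
  have "\<exists>B\<in>carrier_mat n n'. Rk B = min n n' \<and> (\<forall>x\<in>L. f x = B\<^sup>T *\<^sub>v x)"
  proof (rule full_rank_extension[OF L f(1)])
    fix x y assume xy: "x \<in> L" "y \<in> L"
    then have xy': "x + y \<in> L" using L by (simp add: subspace_vec_iff)
    have "outer (A *\<^sub>v e) (f (x + y)) = outer (A *\<^sub>v e) (f x + f y)"
      using xy xy' f(2)[OF e(1)] f(1) outer_in[OF e(1)] L_carrier
      by (simp add: outer_add_right[of "f x" n' "f y"] outer_add_right[of x n y] add
          flip: f(2)[OF e(1)])
    then show "f (x + y) = f x + f y"
      using outer_left_cancel[of "A *\<^sub>v e" _ _ n' m] Ae f(1) xy xy' by simp
  next
    fix c x assume x: "x \<in> L"
    then have cx: "c \<cdot>\<^sub>v x \<in> L" using L by (simp add: subspace_vec_iff)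
    have "outer (A *\<^sub>v e) (f (c \<cdot>\<^sub>v x)) = outer (A *\<^sub>v e) (c \<cdot>\<^sub>v f x)"
      using x cx outer_in[OF e(1)]
      by (simp add: outer_smult_right smult flip: f(2)[OF e(1)])
    then show "f (c \<cdot>\<^sub>v x) = c \<cdot>\<^sub>v f x"
      using outer_left_cancel[of "A *\<^sub>v e" _ _ n' m] Ae f(1) x cx by simp
  next
    fix x assume "x \<in> L" "f x = 0\<^sub>v n'"
    then show "x = 0\<^sub>v n" using nonzero[OF e(1,2), of x] f(2)[OF e(1), of x] Ae by auto
  qed
  then obtain B where B: "B \<in> carrier_mat n n'" "Rk B = min n n'" "\<And>x. x \<in> L \<Longrightarrow> f x = B\<^sup>T *\<^sub>v x"
    by blast
  have "\<phi> (outer u v) = A * outer u v * B" if "u \<in> carrier_vec m" "v \<in> L" for u v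
    using mult_outer[OF A that(1) B(1) L_carrier[OF that(2)]] f(2)[OF that] B(3)[OF that(2)] by simp
  then have "\<forall>C\<in>VL m n L. \<phi> C = A * C * B"
    using factorization_if_outer[OF A B(1)] by blast
  then show ?thesis using A B(1,2) Rk_invertible[OF A Q(1,2)] by blast
qed

section \<open>From P2 and from P3 to preserved lines\<close>

lemma preserves_linesI:
  assumes "\<And>v. v \<in> L \<Longrightarrow> v \<noteq> 0\<^sub>v n \<Longrightarrow> 0 < m \<Longrightarrow>
    \<exists>w\<in>carrier_vec n'. \<forall>u\<in>carrier_vec m. \<forall>i<m. row (\<phi> (outer u v)) i \<in> line w"
  shows preserves_lines
  unfolding preserves_lines_def
proof
  fix v assume v: "v \<in> L"
  show "\<exists>w\<in>carrier_vec n'. \<forall>u\<in>carrier_vec m. \<exists>u'\<in>carrier_vec m. \<phi> (outer u v) = outer u' w"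
  proof (cases "v = 0\<^sub>v n \<or> m = 0")
    case True
    have "\<phi> (outer u v) = outer (0\<^sub>v m) (0\<^sub>v n')" if u: "u \<in> carrier_vec m" for u
    proof -
      have "outer u v = 0\<^sub>m m n" using True u L_carrier[OF v] by (intro eq_matI) auto
      then show ?thesis using zero outer_zero_left[OF zero_carrier_vec, of m n'] by metis
    qed
    then show ?thesis by (intro bexI[of _ "0\<^sub>v n'"]) auto
  next
    case False
    with assms[OF v] obtain w where w: "w \<in> carrier_vec n'"
      and rows: "\<And>u i. u \<in> carrier_vec m \<Longrightarrow> i < m \<Longrightarrow> row (\<phi> (outer u v)) i \<in> line w" by auto
    have "\<exists>u'\<in>carrier_vec m. \<phi> (outer u v) = outer u' w" if u: "u \<in> carrier_vec m" for u
      using rows_in_line[OF maps_carrier[OF outer_in[OF u v]] w rows[OF u]] by blast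
    with w show ?thesis by blast
  qed
qed

lemma subspace_preimage:
  assumes "subspace_mat m n' D"
  shows "subspace_mat m n {C \<in> VL m n L. \<phi> C \<in> D}"
  using assms subspace_VL[OF L, of m] zero by (auto simp: subspace_mat_iff add smult)

text \<open>The image of \<open>VL m n (line v)\<close> is some \<open>VL m n' S\<close>. For a
  nonzero \<open>w\<close> in \<open>S\<close>, P2 read backwards makes the preimage of
  \<open>VL m n' (line w)\<close> a support space \<open>VL m n T\<close>. It shares a nonzero
  matrix with \<open>VL m n (line v)\<close>, so \<open>v\<close> lies in \<open>T\<close>, and then
  every \<open>outer u v\<close> is sent into \<open>VL m n' (line w)\<close>.\<close>

lemma preserves_lines_if_support_spaces:
  assumes P2: "\<And>U. subspace_mat m n U \<Longrightarrow> U \<subseteq> VL m n L \<Longrightarrow>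
    rank_support_space m n U \<longleftrightarrow> rank_support_space m n' (\<phi> ` U)"
  shows preserves_lines
proof (rule preserves_linesI)
  fix v assume v: "v \<in> L" "v \<noteq> 0\<^sub>v n" and m: "0 < m"
  have lv: "subspace_vec n (line v)" using subspace_line L_carrier[OF v(1)] by blast
  let ?U = "VL m n (line v)"
  have U: "subspace_mat m n ?U" "?U \<subseteq> VL m n L"
    using subspace_VL[OF lv] line_subset[OF L v(1)] by (auto simp: VL_def)
  have "rank_support_space m n ?U" using lv by (auto simp: rank_support_space_def)
  with P2[OF U] obtain S where S: "subspace_vec n' S" "\<phi> ` ?U = VL m n' S"
    by (auto simp: rank_support_space_def)
  define e where "e = (unit_vec m 0 :: 'a vec)"
  have e: "e \<in> carrier_vec m" "e \<noteq> 0\<^sub>v m" using m by (auto simp: e_def)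
  have "\<phi> (outer e v) \<noteq> 0\<^sub>m m n'"
    using inj[OF outer_in[OF e(1) v(1)] zero_in] zero outer_eq_zero[of e v m n] e v L_carrier by auto
  moreover have in_S: "\<phi> (outer e v) \<in> VL m n' S"
    using outer_in_VL[OF lv e(1)] S(2) by auto
  ultimately obtain i where i: "i < m" "row (\<phi> (outer e v)) i \<noteq> 0\<^sub>v n'"
    using nonzero_row[OF maps_carrier[OF outer_in[OF e(1) v(1)]]] by blast
  define w where "w = row (\<phi> (outer e v)) i"
  have w: "w \<in> S" "w \<noteq> 0\<^sub>v n'" using in_S i by (auto simp: VL_eq[OF S(1)] w_def)
  have wc: "w \<in> carrier_vec n'" using w S(1) by (auto simp: subspace_vec_iff)
  have lw: "subspace_vec n' (line w)" using wc by (rule subspace_line)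
  let ?W = "{C \<in> VL m n L. \<phi> C \<in> VL m n' (line w)}"
  have lwU: "VL m n' (line w) \<subseteq> \<phi> ` ?U"
    using line_subset[OF S(1) w(1)] S(2) by (auto simp: VL_def)
  then have "\<phi> ` ?W = VL m n' (line w)" using U(2) by auto
  then have "rank_support_space m n' (\<phi> ` ?W)" using lw by (auto simp: rank_support_space_def)
  with P2[of ?W] subspace_preimage[OF subspace_VL[OF lw]] have "rank_support_space m n ?W" by auto
  then obtain T where T: "subspace_vec n T" "?W = VL m n T"
    by (auto simp: rank_support_space_def)
  have ew: "outer e w \<in> VL m n' (line w)" using outer_in_VL[OF lw e(1)] by simp
  \<comment> \<open>A nonzero matrix lying in both support spaces: its nonzero row is in
    \<open>T\<close> and is a multiple of \<open>v\<close>.\<close>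
  then obtain C where C: "C \<in> ?U" "\<phi> C = outer e w" using lwU by fastforce
  have "C \<noteq> 0\<^sub>m m n" using C(2) zero w e outer_eq_zero[of e w m n'] wc by auto
  moreover have "C \<in> carrier_mat m n" using C(1) by (simp add: VL_def)
  ultimately obtain j where j: "j < m" "row C j \<noteq> 0\<^sub>v n" using nonzero_row by blast
  have "C \<in> ?W" using C U(2) ew by auto
  then have CT: "row C j \<in> T" using T(2) j by (auto simp: VL_eq[OF T(1)])
  have "row C j \<in> line v" using C(1) j by (simp add: VL_eq[OF lv])
  then obtain c where c: "row C j = c \<cdot>\<^sub>v v" by (auto simp: line_def)
  have "c \<noteq> 0" using c j L_carrier[OF v(1)] by auto
  then have "v = inverse c \<cdot>\<^sub>v row C j" unfolding c by (simp add: smult_smult_assoc)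
  then have vT: "v \<in> T" using CT T(1) by (metis subspace_vec_iff)
  have "\<phi> (outer u v) \<in> VL m n' (line w)" if "u \<in> carrier_vec m" for u
    using outer_in_VL[OF T(1) that vT] T(2) by blast
  then show "\<exists>w\<in>carrier_vec n'. \<forall>u\<in>carrier_vec m. \<forall>i<m. row (\<phi> (outer u v)) i \<in> line w"
    using wc by (intro bexI[of _ w]) (auto simp: VL_eq[OF lw])
qed

text \<open>\<open>VL m n (line v)\<close> has weight at most one. By P3 its image has, too, so the
  rows of all images lie on a common line.\<close>

lemma preserves_lines_if_weight:
  assumes P3: "\<And>D. subspace_mat m n D \<Longrightarrow> D \<subseteq> VL m n L \<Longrightarrow> wtR n' (\<phi> ` D) = wtR n D"
  shows preserves_lines
proof (rule preserves_linesI)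
  fix v assume v: "v \<in> L"
  have lv: "subspace_vec n (line v)" using subspace_line L_carrier[OF v(1)] by blast
  let ?U = "VL m n (line v)"
  have U: "subspace_mat m n ?U" "?U \<subseteq> VL m n L"
    using subspace_VL[OF lv] line_subset[OF L v(1)] by (auto simp: VL_def)
  have Uc: "?U \<subseteq> carrier_mat m n" by (auto simp: VL_def)
  have "RSupp n ?U \<subseteq> line v" by (rule RSupp_least[OF _ lv]) (auto simp: VL_def)
  from dim_vec_le_1I[OF subspace_RSupp[OF Uc] this]
  have wt: "dim_vec n' (RSupp n' (\<phi> ` ?U)) \<le> 1" using P3[OF U] by (simp add: wtR_def)
  have pc: "\<phi> ` ?U \<subseteq> carrier_mat m n'" using maps_carrier U(2) by auto
  obtain w where w: "w \<in> RSupp n' (\<phi> ` ?U)" "RSupp n' (\<phi> ` ?U) \<subseteq> line w"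
    using dim_vec_le_1D[OF subspace_RSupp[OF pc] wt] .
  have wc: "w \<in> carrier_vec n'" using w(1) subspace_RSupp[OF pc] by (auto simp: subspace_vec_iff)
  have "row (\<phi> (outer u v)) i \<in> line w" if "u \<in> carrier_vec m" "i < m" for u i
  proof -
    have "outer u v \<in> ?U" using outer_in_VL[OF lv that(1)] by simp
    then have "Row (\<phi> (outer u v)) \<subseteq> line w" using Row_subset_RSupp[OF pc] w(2) by blast
    then show ?thesis
      using Row_subset_iff[OF maps_carrier[OF outer_in[OF that(1) v]] subspace_line[OF wc]] that(2)
      by blast
  qed
  with wc show "\<exists>w\<in>carrier_vec n'. \<forall>u\<in>carrier_vec m. \<forall>i<m. row (\<phi> (outer u v)) i \<in> line w"
    by blast
qed

text \<open>Apply P3 to the space of scalar multiples of \<open>C\<close>: its rank support is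
  \<open>Row C\<close>, so its weight is the rank of \<open>C\<close>, and likewise for the
  image.\<close>

lemma rank_if_weight:
  assumes P3: "\<And>D. subspace_mat m n D \<Longrightarrow> D \<subseteq> VL m n L \<Longrightarrow> wtR n' (\<phi> ` D) = wtR n D"
    and C: "C \<in> VL m n L"
  shows "Rk (\<phi> C) = Rk C"
proof -
  have supp: "RSupp k (range (\<lambda>c. c \<cdot>\<^sub>m E)) = Row E" if E: "E \<in> carrier_mat m k" for E :: "'a mat" and k
  proof
    have sub: "range (\<lambda>c. c \<cdot>\<^sub>m E) \<subseteq> carrier_mat m k" using E by auto
    have "\<forall>i<m. row E i \<in> Row E" using Row_subset_iff[OF E subspace_Row[OF E]] by blast
    then have "\<forall>i<m. row (c \<cdot>\<^sub>m E) i \<in> Row E" for c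
      using subspace_Row[OF E] E by (auto simp: subspace_vec_iff)
    then have "Row (c \<cdot>\<^sub>m E) \<subseteq> Row E" for c
      using Row_subset_iff[OF _ subspace_Row[OF E], of "c \<cdot>\<^sub>m E" m] E by auto
    then show "RSupp k (range (\<lambda>c. c \<cdot>\<^sub>m E)) \<subseteq> Row E"
      by (intro RSupp_least[OF _ subspace_Row[OF E]]) auto
    have "E \<in> range (\<lambda>c. c \<cdot>\<^sub>m E)" by (rule range_eqI[of _ _ 1]) (use E in auto)
    then show "Row E \<subseteq> RSupp k (range (\<lambda>c. c \<cdot>\<^sub>m E))" by (rule Row_subset_RSupp[OF sub])
  qed
  let ?D = "range (\<lambda>c. c \<cdot>\<^sub>m C)"
  have Cc: "C \<in> carrier_mat m n" using C by (simp add: VL_def)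
  have "0\<^sub>m m n = 0 \<cdot>\<^sub>m C" using Cc by (intro eq_matI) auto
  then have "0\<^sub>m m n \<in> ?D" by blast
  moreover have "a \<cdot>\<^sub>m C + b \<cdot>\<^sub>m C \<in> ?D" for a b
    by (rule range_eqI[of _ _ "a + b"]) (use Cc in \<open>auto simp: distrib_right\<close>)
  moreover have "a \<cdot>\<^sub>m (b \<cdot>\<^sub>m C) \<in> ?D" for a b
    by (rule range_eqI[of _ _ "a * b"]) (use Cc in \<open>auto simp: mult.assoc\<close>)
  ultimately have D: "subspace_mat m n ?D" using Cc by (auto simp: subspace_mat_iff)
  have DV: "?D \<subseteq> VL m n L" using C subspace_VL[OF L] by (auto simp: subspace_mat_iff)
  have "\<phi> ` ?D = range (\<lambda>c. c \<cdot>\<^sub>m \<phi> C)" using smult[OF C] by (auto simp: image_image)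
  then show ?thesis
    using P3[OF D DV] supp[OF Cc] supp[OF maps_carrier[OF C]] Cc maps_carrier[OF C]
    by (simp add: wtR_def Rk_def)
qed

section \<open>Consequences of a factorization\<close>

context
  fixes A Q B :: "'a mat"
  assumes A: "A \<in> carrier_mat m m" and Q: "Q \<in> carrier_mat m m" "A * Q = 1\<^sub>m m" "Q * A = 1\<^sub>m m"
    and B: "B \<in> carrier_mat n n'" and eq: "\<And>C. C \<in> VL m n L \<Longrightarrow> \<phi> C = A * C * B"
begin

lemma Row_factorization: "C \<in> VL m n L \<Longrightarrow> Row (\<phi> C) = (\<lambda>x. B\<^sup>T *\<^sub>v x) ` Row C"
  using Row_mult[OF A Q _ B, of C] eq[of C] by (simp add: VL_def)

text \<open>Since \<open>\<phi>\<close> moves row spaces by \<open>B\<^sup>T\<close>, the support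
  space of \<open>S\<close> goes to that of its image under \<open>B\<^sup>T\<close>, and in the
  other direction to that of the preimage.\<close>

lemma support_spaces_if_factorization:
  assumes U: "U \<subseteq> VL m n L"
  shows "rank_support_space m n U \<longleftrightarrow> rank_support_space m n' (\<phi> ` U)"
proof
  have BT: "B\<^sup>T \<in> carrier_mat n' n" using B by simp
  assume "rank_support_space m n U"
  then obtain S where S: "subspace_vec n S" "U = VL m n S" by (auto simp: rank_support_space_def)
  let ?S = "(\<lambda>x. B\<^sup>T *\<^sub>v x) ` S"
  have BS: "subspace_vec n' ?S" using subspace_image[OF S(1) BT] .
  have "\<phi> ` U = VL m n' ?S"
  proof (intro equalityI subsetI)
    fix D assume "D \<in> \<phi> ` U"
    then obtain C where C: "C \<in> U" "D = \<phi> C" by blast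
    then have "Row D = (\<lambda>x. B\<^sup>T *\<^sub>v x) ` Row C" using Row_factorization U by blast
    moreover have "Row C \<subseteq> S" using C(1) S(2) by (simp add: VL_def)
    ultimately have "Row D \<subseteq> ?S" by blast
    then show "D \<in> VL m n' ?S" using C maps_carrier U by (auto simp: VL_def)
  next
    fix D assume "D \<in> VL m n' ?S"
    then have Dc: "D \<in> carrier_mat m n'" and "\<forall>i. \<exists>s. i < m \<longrightarrow> s \<in> S \<and> row D i = B\<^sup>T *\<^sub>v s"
      by (auto simp: VL_eq[OF BS])
    then obtain s where s: "\<And>i. i < m \<Longrightarrow> s i \<in> S" "\<And>i. i < m \<Longrightarrow> row D i = B\<^sup>T *\<^sub>v s i"
      by metis
    \<comment> \<open>Stacking preimages of the rows of \<open>D\<close> under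
      \<open>B\<^sup>T\<close> gives \<open>C * B = D\<close>. The preimage of \<open>D\<close>
      under \<open>\<phi>\<close> is then \<open>Q * C\<close>, where \<open>Q\<close> cancels
      \<open>A\<close> without changing the row space.\<close>
    define C where "C = mat m n (\<lambda>(i,j). s i $ j)"
    have C: "C \<in> carrier_mat m n" by (simp add: C_def)
    have sc: "s i \<in> carrier_vec n" if "i < m" for i using s(1)[OF that] S(1) by (auto simp: subspace_vec_iff)
    have rowC: "row C i = s i" if "i < m" for i
      using that sc[OF that] by (intro eq_vecI) (auto simp: C_def)
    have "C * B = D"
    proof (rule eq_rowI)
      fix i assume "i < dim_row D"
      then have i: "i < m" using Dc by simp
      have "row (C * B) i = B\<^sup>T *\<^sub>v row C i"
        using B C i by (intro eq_vecI) (auto simp: comm_scalar_prod[of _ n])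
      then show "row (C * B) i = row D i" using rowC[OF i] s(2)[OF i] by simp
    qed (use B C Dc in auto)
    have "Row C \<subseteq> S" using Row_subset_iff[OF C S(1)] rowC s(1) by simp
    moreover have "Row (Q * C) = Row C"
    proof -
      have "Row (Q * C * 1\<^sub>m n) = (\<lambda>x. x) ` Row C"
        unfolding Row_mult[OF Q(1) A Q(3,2) C one_carrier_mat]
        using subspace_Row[OF C] by (intro image_cong) (auto simp: subspace_vec_iff)
      then show ?thesis using Q(1) C by simp
    qed
    ultimately have QC: "Q * C \<in> U" using S(2) Q(1) C by (simp add: VL_def)
    have "\<phi> (Q * C) = A * (Q * C) * B" using eq QC U by blast
    also have "A * (Q * C) = C" using assoc_mult_mat[OF A Q(1) C] Q(2) C by simp
    finally show "D \<in> \<phi> ` U" using QC \<open>C * B = D\<close> by force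
  qed
  then show "rank_support_space m n' (\<phi> ` U)" using BS by (auto simp: rank_support_space_def)
next
  have BT: "B\<^sup>T \<in> carrier_mat n' n" using B by simp
  assume "rank_support_space m n' (\<phi> ` U)"
  then obtain S where S: "subspace_vec n' S" "\<phi> ` U = VL m n' S"
    by (auto simp: rank_support_space_def)
  \<comment> \<open>The preimage is cut down to \<open>L\<close>, since the factorization is known
    on \<open>VL m n L\<close> only.\<close>
  let ?S = "{x \<in> L. B\<^sup>T *\<^sub>v x \<in> S}"
  have "C \<in> U \<longleftrightarrow> C \<in> VL m n ?S" for C
  proof -
    have "C \<in> U \<longleftrightarrow> C \<in> VL m n L \<and> \<phi> C \<in> \<phi> ` U" using inj U by blast
    also have "\<dots> \<longleftrightarrow> C \<in> VL m n L \<and> Row (\<phi> C) \<subseteq> S"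
      using S(2) maps_carrier by (auto simp: VL_def)
    also have "\<dots> \<longleftrightarrow> C \<in> VL m n L \<and> (\<lambda>x. B\<^sup>T *\<^sub>v x) ` Row C \<subseteq> S"
      using Row_factorization by auto
    also have "\<dots> \<longleftrightarrow> C \<in> VL m n ?S" by (auto simp: VL_def)
    finally show ?thesis .
  qed
  then show "rank_support_space m n U"
    using subspace_vimage[OF L S(1) BT] unfolding rank_support_space_def by blast
qed

text \<open>The rank support of the image is the image under \<open>B\<^sup>T\<close> of the rank
  support. No dimension is lost: if \<open>B\<^sup>T\<close> kills \<open>x\<close> in
  \<open>L\<close>, then \<open>\<phi>\<close> kills \<open>outer e x\<close> for a nonzero
  \<open>e\<close>, so \<open>x\<close> is zero.\<close>

lemma weight_if_factorization:
  assumes D: "D \<subseteq> VL m n L"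
  shows "wtR n' (\<phi> ` D) = wtR n D"
proof -
  have BT: "B\<^sup>T \<in> carrier_mat n' n" using B by simp
  have Dc: "D \<subseteq> carrier_mat m n" using D by (auto simp: VL_def)
  have pc: "\<phi> ` D \<subseteq> carrier_mat m n'" using D maps_carrier by auto
  let ?R = "RSupp n D"
  have "RSupp n' (\<phi> ` D) = (\<lambda>x. B\<^sup>T *\<^sub>v x) ` ?R"
  proof
    show "RSupp n' (\<phi> ` D) \<subseteq> (\<lambda>x. B\<^sup>T *\<^sub>v x) ` ?R"
    proof (rule RSupp_least[OF _ subspace_image[OF subspace_RSupp[OF Dc] BT]])
      fix E assume "E \<in> \<phi> ` D"
      then obtain C where C: "C \<in> D" "E = \<phi> C" by blast
      then have "Row E = (\<lambda>x. B\<^sup>T *\<^sub>v x) ` Row C" using Row_factorization D by blast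
      then show "Row E \<subseteq> (\<lambda>x. B\<^sup>T *\<^sub>v x) ` ?R" using Row_subset_RSupp[OF Dc C(1)] by blast
    qed
    have "?R \<subseteq> {x \<in> carrier_vec n. B\<^sup>T *\<^sub>v x \<in> RSupp n' (\<phi> ` D)}"
    proof (rule RSupp_least[OF _ subspace_vimage[OF subspace_vec_carrier subspace_RSupp[OF pc] BT]])
      fix C assume C: "C \<in> D"
      then have "(\<lambda>x. B\<^sup>T *\<^sub>v x) ` Row C = Row (\<phi> C)" using Row_factorization D by blast
      also have "\<dots> \<subseteq> RSupp n' (\<phi> ` D)" using C by (intro Row_subset_RSupp[OF pc]) simp
      finally have "(\<lambda>x. B\<^sup>T *\<^sub>v x) ` Row C \<subseteq> RSupp n' (\<phi> ` D)" .
      moreover have "C \<in> carrier_mat m n" using C Dc by blast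
      then have "Row C \<subseteq> carrier_vec n" using subspace_Row[of C m n] by (simp add: subspace_vec_iff)
      ultimately show "Row C \<subseteq> {x \<in> carrier_vec n. B\<^sup>T *\<^sub>v x \<in> RSupp n' (\<phi> ` D)}" by blast
    qed
    then show "(\<lambda>x. B\<^sup>T *\<^sub>v x) ` ?R \<subseteq> RSupp n' (\<phi> ` D)" by blast
  qed
  moreover have "x = 0\<^sub>v n" if x: "x \<in> ?R" "B\<^sup>T *\<^sub>v x = 0\<^sub>v n'" for x
  \<comment> \<open>Without rows there is no nonzero \<open>e\<close> to test with, but then the
    rank support is zero.\<close>
  proof (cases "m = 0")
    case True
    have z: "subspace_vec n {0\<^sub>v n}" by (auto simp: subspace_vec_iff)
    have "?R \<subseteq> {0\<^sub>v n}"
      using Row_subset_iff[OF _ z] Dc True by (intro RSupp_least[OF _ z]) blast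
    then show ?thesis using x by blast
  next
    case False
    have "?R \<subseteq> L" using D by (intro RSupp_least[OF _ L]) (auto simp: VL_def)
    then have xL: "x \<in> L" using x by blast
    define e where "e = (unit_vec m 0 :: 'a vec)"
    have e: "e \<in> carrier_vec m" "e \<noteq> 0\<^sub>v m" using False by (auto simp: e_def)
    have "\<phi> (outer e x) = 0\<^sub>m m n'"
      using eq[OF outer_in[OF e(1) xL]] mult_outer[OF A e(1) B L_carrier[OF xL]] x(2) e(1) A by simp
    then have "outer e x = 0\<^sub>m m n" using inj[OF outer_in[OF e(1) xL] zero_in] zero by simp
    then show ?thesis using outer_eq_zero[OF _ e(1) L_carrier[OF xL] e(2)] by simp
  qed
  ultimately show ?thesis
    using dim_vec_image[OF subspace_RSupp[OF Dc] BT] by (simp add: wtR_def)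
qed

end

end

section \<open>Rank-one preservers\<close>

lemma line_trans: "x \<in> line y \<Longrightarrow> y \<in> line z \<Longrightarrow> x \<in> line z"
  by (auto simp: line_def smult_smult_assoc)

lemma line_sym:
  assumes "x \<in> line y" "x \<noteq> 0\<^sub>v n" "y \<in> carrier_vec n"
  shows "y \<in> line x"
proof -
  obtain c where c: "x = c \<cdot>\<^sub>v y" using assms(1) by (auto simp: line_def)
  have "c \<noteq> 0" using c assms by auto
  then have "y = inverse c \<cdot>\<^sub>v x" unfolding c by (simp add: smult_smult_assoc)
  then show ?thesis by (metis smult_in_line)
qed

text \<open>All two-by-two minors of the matrix with columns \<open>a\<close> and \<open>c\<close>
  vanish, so the quotient at a nonzero entry of \<open>a\<close> is the common factor.\<close>

lemma in_line_if_minors: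
  assumes a: "a \<in> carrier_vec m" "a \<noteq> 0\<^sub>v m" and c: "c \<in> carrier_vec m"
    and minors: "\<And>i j. i < m \<Longrightarrow> j < m \<Longrightarrow> a $ i * c $ j = a $ j * c $ i"
  shows "c \<in> line a"
proof -
  obtain i where i: "i < m" "a $ i \<noteq> 0" using nonzero_entry[OF a] .
  have "c = (c $ i / a $ i) \<cdot>\<^sub>v a"
    using a c i minors[OF i(1)] by (intro eq_vecI) (auto simp: field_simps)
  then show ?thesis by (metis smult_in_line)
qed

text \<open>By Cauchy-Binet, each two-by-two minor of the left-hand sum is a minor of
  \<open>a\<close>, \<open>c\<close> times a minor of \<open>b\<close>, \<open>d\<close>. It
  vanishes because the sum has rank at most one, so one nonzero minor of \<open>a\<close>,
  \<open>c\<close> forces all minors of \<open>b\<close>, \<open>d\<close> to vanish.\<close>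

lemma rank_one_sum:
  assumes eq: "outer a b + outer c d = outer x y"
    and ac: "a \<in> carrier_vec m" "c \<in> carrier_vec m" "x \<in> carrier_vec m" "a \<noteq> 0\<^sub>v m"
    and bd: "b \<in> carrier_vec n" "d \<in> carrier_vec n" "y \<in> carrier_vec n" "b \<noteq> 0\<^sub>v n"
  shows "c \<in> line a \<or> d \<in> line b"
proof (cases "c \<in> line a")
  case False
  then obtain i j where ij: "i < m" "j < m" "a $ i * c $ j \<noteq> a $ j * c $ i"
    using in_line_if_minors[OF ac(1,4,2)] by blast
  have entry: "a $ i * b $ k + c $ i * d $ k = x $ i * y $ k" if "i < m" "k < n" for i k
    using arg_cong[OF eq, of "\<lambda>C. C $$ (i,k)"] that ac bd by simp
  have "d \<in> line b"
  proof (rule in_line_if_minors[OF bd(1,4,2)])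
    fix k l assume kl: "k < n" "l < n"
    have "(a $ i * c $ j - a $ j * c $ i) * (b $ k * d $ l - b $ l * d $ k)
      = (a $ i * b $ k + c $ i * d $ k) * (a $ j * b $ l + c $ j * d $ l)
      - (a $ i * b $ l + c $ i * d $ l) * (a $ j * b $ k + c $ j * d $ k)"
      by (simp add: algebra_simps)
    also have "\<dots> = 0" using ij kl by (simp add: entry)
    finally show "b $ k * d $ l = b $ l * d $ k" using ij(3) by simp
  qed
  then show ?thesis ..
qed simp

lemma Rk_outer_le:
  assumes "u \<in> carrier_vec m" "v \<in> carrier_vec n"
  shows "Rk (outer u v) \<le> 1"
proof -
  have C: "outer u v \<in> carrier_mat m n" using assms by simp
  have "Row (outer u v) \<subseteq> line v"
    using Row_subset_iff[OF C subspace_line[OF assms(2)]] assms by simp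
  from dim_vec_le_1I[OF subspace_Row[OF C] this] show ?thesis using assms by (simp add: Rk_def)
qed

lemma outer_if_Rk_le:
  assumes C: "C \<in> carrier_mat m n" and "Rk C \<le> 1"
  obtains u v where "u \<in> carrier_vec m" "v \<in> carrier_vec n" "C = outer u v"
proof -
  have "dim_vec n (Row C) \<le> 1" using assms by (simp add: Rk_def)
  then obtain w where w: "w \<in> Row C" "Row C \<subseteq> line w"
    using dim_vec_le_1D[OF subspace_Row[OF C]] by blast
  have wc: "w \<in> carrier_vec n" using w(1) subspace_Row[OF C] by (auto simp: subspace_vec_iff)
  have "\<forall>i<m. row C i \<in> line w" using w(2) Row_subset_iff[OF C subspace_line[OF wc]] by simp
  then show ?thesis using rows_in_line[OF C wc] that wc by metis
qed

text \<open>Any two images \<open>outer (a x) (b x)\<close> and \<open>outer (a y) (b y)\<close>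
  have a sum of rank at most one, hence proportional column factors or proportional row factors. If
  two row factors were not proportional, all column factors would be, and \<open>\<phi>\<close>
  would embed vectors of length \<open>m\<close> linearly into those of length
  \<open>n'\<close>.\<close>

lemma (in rank_support_iso) preserves_lines_if_rank_one:
  assumes less: "n' < m"
    and rank_one: "\<And>u v. u \<in> carrier_vec m \<Longrightarrow> v \<in> L \<Longrightarrow>
      \<exists>a\<in>carrier_vec m. \<exists>b\<in>carrier_vec n'. \<phi> (outer u v) = outer a b"
  shows preserves_lines
proof (rule preserves_linesI)
  fix v assume v: "v \<in> L" "v \<noteq> 0\<^sub>v n" and m: "0 < m"
  obtain a b where a: "\<And>u. u \<in> carrier_vec m \<Longrightarrow> a u \<in> carrier_vec m"
    and b: "\<And>u. u \<in> carrier_vec m \<Longrightarrow> b u \<in> carrier_vec n'"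
    and ab: "\<And>u. u \<in> carrier_vec m \<Longrightarrow> \<phi> (outer u v) = outer (a u) (b u)"
    using rank_one[OF _ v(1)] by metis
  have phi_nz: "u = 0\<^sub>v m" if "u \<in> carrier_vec m" "\<phi> (outer u v) = 0\<^sub>m m n'" for u
    using that inj[OF outer_in[OF that(1) v(1)] zero_in] zero outer_eq_zero[of u v m n]
      v L_carrier by auto
  have a_nz: "a u \<noteq> 0\<^sub>v m" and b_nz: "b u \<noteq> 0\<^sub>v n'" if "u \<in> carrier_vec m" "u \<noteq> 0\<^sub>v m" for u
    using phi_nz[OF that(1)] ab[OF that(1)] a[OF that(1)] b[OF that(1)] that(2) by auto
  have phi_add: "\<phi> (outer (x + y) v) = \<phi> (outer x v) + \<phi> (outer y v)"
    if "x \<in> carrier_vec m" "y \<in> carrier_vec m" for x y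
    using outer_add_left[OF that] add[OF outer_in outer_in] that v(1) by simp
  have par: "a y \<in> line (a x) \<or> b y \<in> line (b x)"
    if x: "x \<in> carrier_vec m" "x \<noteq> 0\<^sub>v m" and y: "y \<in> carrier_vec m" for x y
  proof (rule rank_one_sum)
    have xy: "x + y \<in> carrier_vec m" using x y by simp
    show "outer (a x) (b x) + outer (a y) (b y) = outer (a (x + y)) (b (x + y))"
      using phi_add[OF x(1) y] ab[OF x(1)] ab[OF y] ab[OF xy] by simp
    show "a (x + y) \<in> carrier_vec m" "b (x + y) \<in> carrier_vec n'" using a b xy by auto
  qed (use a b x y a_nz b_nz in auto)
  have b_line: "b u2 \<in> line (b u1)"
    if u1: "u1 \<in> carrier_vec m" "u1 \<noteq> 0\<^sub>v m" and u2: "u2 \<in> carrier_vec m" "u2 \<noteq> 0\<^sub>v m" for u1 u2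
  proof (rule ccontr)
    assume notin: "b u2 \<notin> line (b u1)"
    then have a21: "a u2 \<in> line (a u1)" using par[OF u1 u2(1)] by simp
    \<comment> \<open>\<open>b u\<close> cannot be proportional to both \<open>b u1\<close> and
      \<open>b u2\<close>. Comparing \<open>u\<close> with whichever of \<open>u1\<close> and
      \<open>u2\<close> fails gives proportional column factors, and those of \<open>u1\<close> and
      \<open>u2\<close> agree up to a scalar.\<close>
    have a_line: "a u \<in> line (a u1)" if u: "u \<in> carrier_vec m" "u \<noteq> 0\<^sub>v m" for u
    proof (cases "b u \<in> line (b u1)")
      case True
      have "b u \<notin> line (b u2)"
        using line_sym[OF _ b_nz[OF u] b[OF u2(1)]] line_trans[OF _ True] notin by blast
      then show ?thesis using par[OF u2 u(1)] line_trans[OF _ a21] by blast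
    qed (use par[OF u1 u(1)] in simp)
    have "\<exists>z\<in>carrier_vec n'. \<phi> (outer u v) = outer (a u1) z" if u: "u \<in> carrier_vec m" for u
    proof (cases "u = 0\<^sub>v m")
      case True
      then have "\<phi> (outer u v) = outer (a u1) (0\<^sub>v n')"
        using zero a[OF u1(1)] L_carrier[OF v(1)] by simp
      then show ?thesis by (rule bexI[OF _ zero_carrier_vec])
    next
      case False
      with a_line[OF u] obtain c where "a u = c \<cdot>\<^sub>v a u1" by (auto simp: line_def)
      then have "\<phi> (outer u v) = outer (a u1) (c \<cdot>\<^sub>v b u)"
        using ab[OF u] by (simp add: outer_smult_left outer_smult_right)
      then show ?thesis using b[OF u] by (intro bexI[of _ "c \<cdot>\<^sub>v b u"]) auto
    qed
    then obtain g where g: "\<And>u. u \<in> carrier_vec m \<Longrightarrow> g u \<in> carrier_vec n'"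
      "\<And>u. u \<in> carrier_vec m \<Longrightarrow> \<phi> (outer u v) = outer (a u1) (g u)" by metis
    note cancel = outer_left_cancel[where n = n', OF _ _ _ a[OF u1(1)] a_nz[OF u1]]
    \<comment> \<open>The matrix of \<open>g\<close>. Its kernel is trivial because
      \<open>\<phi>\<close> is injective, which contradicts \<open>n' < m\<close>.\<close>
    define G where "G = mat n' m (\<lambda>(i,j). g (col (1\<^sub>m m) j) $ i)"
    have gG: "g u = G *\<^sub>v u" if u: "u \<in> carrier_vec m" for u
    proof -
      have "g (1\<^sub>m m *\<^sub>v u) = G *\<^sub>v u" unfolding G_def
      proof (rule linear_on_range[OF subspace_vec_carrier _ _ g(1) _ _ u])
        fix x y :: "'a vec" assume xy: "x \<in> carrier_vec m" "y \<in> carrier_vec m"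
        then have xy': "x + y \<in> carrier_vec m" by simp
        have "outer (a u1) (g (x + y)) = outer (a u1) (g x + g y)"
          using phi_add[OF xy] g(2)[OF xy(1)] g(2)[OF xy(2)] g(2)[OF xy']
            outer_add_right[OF g(1)[OF xy(1)] g(1)[OF xy(2)]] by simp
        then show "g (x + y) = g x + g y" by (rule cancel) (use g(1) xy xy' in auto)
      next
        fix c and x :: "'a vec" assume x: "x \<in> carrier_vec m"
        then have cx: "c \<cdot>\<^sub>v x \<in> carrier_vec m" by simp
        have "outer (a u1) (g (c \<cdot>\<^sub>v x)) = outer (a u1) (c \<cdot>\<^sub>v g x)"
          using smult[OF outer_in[OF x v(1)], of c] g(2)[OF x] g(2)[OF cx]
          by (simp add: outer_smult_left outer_smult_right)
        then show "g (c \<cdot>\<^sub>v x) = c \<cdot>\<^sub>v g x" by (rule cancel) (use g(1) x cx in auto)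
      qed auto
      then show ?thesis using u by simp
    qed
    have "inj_mat n' m G" unfolding inj_mat_def
    proof (intro conjI ballI impI)
      show "G \<in> carrier_mat n' m" by (simp add: G_def)
      fix y :: "'a vec" assume y: "y \<in> carrier_vec m" "G *\<^sub>v y = 0\<^sub>v n'"
      then have "\<phi> (outer y v) = 0\<^sub>m m n'" using g(2)[OF y(1)] gG[OF y(1)] a[OF u1(1)] by simp
      then show "y = 0\<^sub>v m" by (rule phi_nz[OF y(1)])
    qed
    then show False using inj_mat_le less by fastforce
  qed
  \<comment> \<open>A reference vector: all row factors lie on the line of
    \<open>b e\<close>.\<close>
  define e where "e = (unit_vec m 0 :: 'a vec)"
  have e: "e \<in> carrier_vec m" "e \<noteq> 0\<^sub>v m" using m by (auto simp: e_def)
  have "row (\<phi> (outer u v)) i \<in> line (b e)" if u: "u \<in> carrier_vec m" and i: "i < m" for u i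
  proof (cases "u = 0\<^sub>v m")
    case True
    then have "row (\<phi> (outer u v)) i = 0 \<cdot>\<^sub>v b e"
      using zero i b[OF e(1)] L_carrier[OF v(1)] by (intro eq_vecI) auto
    then show ?thesis by simp
  next
    case False
    have "row (\<phi> (outer u v)) i = a u $ i \<cdot>\<^sub>v b u" using ab[OF u] a[OF u] i by simp
    then have "row (\<phi> (outer u v)) i \<in> line (b u)" by simp
    then show ?thesis using b_line[OF e u False] by (rule line_trans)
  qed
  then show "\<exists>w\<in>carrier_vec n'. \<forall>u\<in>carrier_vec m. \<forall>i<m. row (\<phi> (outer u v)) i \<in> line w"
    using b[OF e(1)] by blast
qed

section \<open>Full matrix spaces, transposition and the equivalences\<close>

lemma VL_carrier_vec: "VL m n (carrier_vec n) = carrier_mat m n"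
  by (auto simp: VL_eq[OF subspace_vec_carrier])

lemma bij_betw_transpose: "bij_betw transpose_mat (carrier_mat m n) (carrier_mat n m)"
  by (rule bij_betwI[where g = transpose_mat]) auto

theorem theorem4:
  fixes m n n' :: nat
    and L :: "'a::field vec set" and L' :: "'a vec set"
    and \<V> \<W> :: "'a mat set"
    and \<phi> :: "'a mat \<Rightarrow> 'a mat"
  assumes L: "subspace_vec n L" and L': "subspace_vec n' L'"
    and V: "\<V> = VL m n L" and W: "\<W> = VL m n' L'"
    and add: "\<And>C D. C \<in> \<V> \<Longrightarrow> D \<in> \<V> \<Longrightarrow> \<phi> (C + D) = \<phi> C + \<phi> D"
    and smult: "\<And>a C. C \<in> \<V> \<Longrightarrow> \<phi> (a \<cdot>\<^sub>m C) = a \<cdot>\<^sub>m \<phi> C"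
    and bij: "bij_betw \<phi> \<V> \<W>"
  defines "P1 \<equiv> (\<exists>A \<in> carrier_mat m m. \<exists>B \<in> carrier_mat n n'.
                   Rk A = m \<and> Rk B = min n n' \<and> (\<forall>C \<in> \<V>. \<phi> C = A * C * B))"
    and "P2 \<equiv> (\<forall>\<U>. subspace_mat m n \<U> \<and> \<U> \<subseteq> \<V> \<longrightarrow>
                   (rank_support_space m n \<U> \<longleftrightarrow> rank_support_space m n' (\<phi> ` \<U>)))"
    and "P3 \<equiv> (\<forall>\<D>. subspace_mat m n \<D> \<and> \<D> \<subseteq> \<V> \<longrightarrow> wtR n' (\<phi> ` \<D>) = wtR n \<D>)"
    and "P4 \<equiv> (\<forall>C \<in> \<V>. Rk (\<phi> C) = Rk C)"
  shows "(P1 \<longleftrightarrow> P2) \<and> (P2 \<longleftrightarrow> P3) \<and> (P3 \<longrightarrow> P4)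
         \<and> (\<V> = carrier_mat m n \<and> \<W> = carrier_mat m n' \<and> n' = n \<and> m \<noteq> n \<longrightarrow> (P4 \<longrightarrow> P1))"
proof -
  interpret rank_support_iso m n n' L L' \<phi>
    using L L' add smult bij unfolding V W by unfold_locales auto
  have lines: P1 if preserves_lines
    unfolding P1_def V by (rule factorization_if_preserves_lines[OF that])
  have P23: "P2 \<and> P3" if p1: P1
  proof -
    obtain A B where A: "A \<in> carrier_mat m m" "Rk A = m" and B: "B \<in> carrier_mat n n'"
      and eq: "\<And>C. C \<in> VL m n L \<Longrightarrow> \<phi> C = A * C * B"
      using p1 unfolding P1_def V by blast
    obtain Q where Q: "Q \<in> carrier_mat m m" "A * Q = 1\<^sub>m m" "Q * A = 1\<^sub>m m"
      using Rk_full_imp_invertible[OF A] .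
    show ?thesis unfolding P2_def P3_def V
      using support_spaces_if_factorization[OF A(1) Q B eq] weight_if_factorization[OF A(1) Q B eq]
      by blast
  qed
  have P21: P1 if P2
    using that unfolding P2_def V by (intro lines preserves_lines_if_support_spaces) blast
  have P31: P1 if P3
    using that unfolding P3_def V by (intro lines preserves_lines_if_weight) blast
  have P34: P4 if P3
    using that rank_if_weight unfolding P3_def P4_def V by blast
  have P41: P1 if full: "\<V> = carrier_mat m n" "\<W> = carrier_mat m n'" "n' = n" "m \<noteq> n" and P4
  proof -
    have in_V: "C \<in> carrier_mat m n \<Longrightarrow> C \<in> VL m n L" for C using full(1) V by simp
    have rank_one: "\<exists>a\<in>carrier_vec m. \<exists>b\<in>carrier_vec n'. \<phi> (outer u v) = outer a b"
      if "u \<in> carrier_vec m" "v \<in> carrier_vec n" for u v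
    proof -
      have uv: "outer u v \<in> VL m n L" using that in_V by simp
      have "Rk (\<phi> (outer u v)) \<le> 1" using \<open>P4\<close> uv Rk_outer_le[OF that] unfolding P4_def V by simp
      from outer_if_Rk_le[OF maps_carrier[OF uv] this] show ?thesis by metis
    qed
    show P1
    \<comment> \<open>Excluding a common column factor takes more rows than columns. For
      \<open>m < n\<close> this is arranged by conjugating \<open>\<phi>\<close> with
      transposition.\<close>
    proof (cases "n < m")
      case True
      then show ?thesis
        using rank_one L_carrier full(3) by (intro lines preserves_lines_if_rank_one) auto
    next
      case False
      then have less: "m < n" using full(4) by simp
      define \<psi> where "\<psi> = transpose_mat \<circ> \<phi> \<circ> transpose_mat"
      have bij\<phi>: "bij_betw \<phi> (carrier_mat m n) (carrier_mat m n)" using \<open>bij_betw \<phi> \<V> \<W>\<close> full by simp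
      interpret T: rank_support_iso n m m "carrier_vec m" "carrier_vec m" \<psi>
      proof (unfold_locales, unfold VL_carrier_vec)
        show "bij_betw \<psi> (carrier_mat n m) (carrier_mat n m)"
          unfolding \<psi>_def using bij\<phi> bij_betw_transpose by (intro bij_betw_trans) 
        have tc: "\<phi> (C\<^sup>T) \<in> carrier_mat m n" if "C \<in> carrier_mat n m" for C
          using that maps_carrier[OF in_V, of "C\<^sup>T"] full(3) by simp
        show "\<psi> (C + D) = \<psi> C + \<psi> D" if "C \<in> carrier_mat n m" "D \<in> carrier_mat n m" for C D
          using that tc[OF that(1)] tc[OF that(2)] in_V
          by (simp add: \<psi>_def transpose_add[where nr=n and nc=m] transpose_add[where nr=m and nc=n] add)
        show "\<psi> (c \<cdot>\<^sub>m C) = c \<cdot>\<^sub>m \<psi> C" if "C \<in> carrier_mat n m" for c C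
        proof -
          have "(c \<cdot>\<^sub>m C)\<^sup>T = c \<cdot>\<^sub>m C\<^sup>T" by (intro eq_matI) auto
          moreover have "(c \<cdot>\<^sub>m \<phi> (C\<^sup>T))\<^sup>T = c \<cdot>\<^sub>m (\<phi> (C\<^sup>T))\<^sup>T" by (intro eq_matI) auto
          moreover have "\<phi> (c \<cdot>\<^sub>m C\<^sup>T) = c \<cdot>\<^sub>m \<phi> (C\<^sup>T)" using that in_V by (intro smult) simp
          ultimately show ?thesis by (simp add: \<psi>_def)
        qed
      qed (auto simp: subspace_vec_carrier)
      \<comment> \<open>Transposition swaps the two factors of \<open>outer u v\<close>, so
        \<open>\<psi>\<close> inherits the rank-one property of \<open>\<phi>\<close>.\<close>
      have "T.preserves_lines"
      proof (rule T.preserves_lines_if_rank_one[OF less])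
        fix u v :: "'a vec" assume "u \<in> carrier_vec n" "v \<in> carrier_vec m"
        then obtain a b where "a \<in> carrier_vec m" "b \<in> carrier_vec n'" "\<phi> (outer v u) = outer a b"
          using rank_one by blast
        then show "\<exists>a\<in>carrier_vec n. \<exists>b\<in>carrier_vec m. \<psi> (outer u v) = outer a b"
          using full(3) by (auto simp: \<psi>_def transpose_outer)
      qed
      from T.factorization_if_preserves_lines[OF this] obtain A B where
        A: "A \<in> carrier_mat n n" "Rk A = n" and B: "B \<in> carrier_mat m m" "Rk B = m"
        and eq: "\<And>C. C \<in> carrier_mat n m \<Longrightarrow> \<psi> C = A * C * B" unfolding VL_carrier_vec by auto
      have Rk_transpose: "Rk (M\<^sup>T) = k" if M: "M \<in> carrier_mat k k" "Rk M = k" for M :: "'a mat" and k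
      proof -
        obtain Q where Q: "Q \<in> carrier_mat k k" "M * Q = 1\<^sub>m k" "Q * M = 1\<^sub>m k"
          using Rk_full_imp_invertible[OF M] .
        have "M\<^sup>T * Q\<^sup>T = 1\<^sub>m k" using transpose_mult[OF Q(1) M(1)] Q(3) by simp
        then show ?thesis using Rk_invertible[of "M\<^sup>T" k "Q\<^sup>T"] M(1) Q(1) by simp
      qed
      \<comment> \<open>Transposing back exchanges the roles of \<open>A\<close> and
        \<open>B\<close>. Both are square, so their full rank survives transposition.\<close>
      have "\<phi> C = B\<^sup>T * C * A\<^sup>T" if C: "C \<in> carrier_mat m n" for C
      proof -
        have "\<phi> C = (\<psi> (C\<^sup>T))\<^sup>T" by (simp add: \<psi>_def)
        also have "\<dots> = (A * C\<^sup>T * B)\<^sup>T" using eq[of "C\<^sup>T"] C by simp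
        also have "\<dots> = B\<^sup>T * (C * A\<^sup>T)"
          using transpose_mult[of "A * C\<^sup>T" n m B m] transpose_mult[of A n n "C\<^sup>T" m] A B C by simp
        also have "\<dots> = B\<^sup>T * C * A\<^sup>T" using assoc_mult_mat[of "B\<^sup>T" m m C n "A\<^sup>T" n] A B C by simp
        finally show ?thesis .
      qed
      then show P1 unfolding P1_def full(1)
        using Rk_transpose[OF A] Rk_transpose[OF B] A B full(3)
        by (intro bexI[of _ "B\<^sup>T"] bexI[of _ "A\<^sup>T"]) auto
    qed
  qed
  show ?thesis using P23 P21 P31 P34 P41 by blast
qed

end
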